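(* Let $\gamma=(x,y)$ be a smooth nondegenerate curve in the equi-affine plane, parametrised by equi-affine arc-length $s$, with equi-affine curvature $\kappa$. Then $\gamma$ is a critical point of the total equi-affine curvature $\int\kappa\,\mathrm{d}s$ (with respect to compactly supported variations) if and only if there exist constants $A,B\in\mathbb{R}$ with $\kappa=A\,x'+B\,y'$; i.e., the centro-affine curvature of the tangent image $T=\gamma'$ is a linear function of its position vector.
   Context: The equi-affine plane is $\mathbb{R}^2$ with the area form $|u,v|=\det(u,v)$. A curve $\gamma$ is parametrised by equi-affine arc-length $s$ if $|\gamma',\gamma''|=1$ everywhere; primes denote derivatives with respect to $s$. The equi-affine tangent is $T=\gamma'$, the Blaschke normal is $N=\gamma''$, and the equi-affine curvature $\kappa$ is defined by $\gamma'''=-\kappa\,\gamma'$. The centro-affine curvature of the curve $s\mapsto T(s)$ is $\kappa$ itself in the sense that $T''=-\kappa T$. A curve is a critical point of a functional if the first variation of the functional vanishes for every smooth compactly supported variation (for closed curves, every smooth variation), the functional being computed for each varied curve with its own equi-affine arc-length and curvature. *)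

theory Defs
  imports "HOL-Analysis.Analysis"
begin

definition det2 :: "real \<Rightarrow> real \<Rightarrow> real \<Rightarrow> real \<Rightarrow> real" where
  "det2 a b c d = a * d - b * c"

definition smooth1_on :: "real set \<Rightarrow> (real \<Rightarrow> real) \<Rightarrow> bool" where
  "smooth1_on I f \<longleftrightarrow> (\<forall>n. \<forall>t\<in>I. ((deriv ^^ n) f) differentiable (at t))"

fun pdiff :: "bool list \<Rightarrow> (real \<Rightarrow> real \<Rightarrow> real) \<Rightarrow> real \<Rightarrow> real \<Rightarrow> real" where
  "pdiff [] F = F"
| "pdiff (True # bs) F = (\<lambda>e t. deriv (\<lambda>e'. pdiff bs F e' t) e)"
| "pdiff (False # bs) F = (\<lambda>e t. deriv (\<lambda>t'. pdiff bs F e t') t)"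

definition smooth2_on :: "(real \<times> real) set \<Rightarrow> (real \<Rightarrow> real \<Rightarrow> real) \<Rightarrow> bool" where
  "smooth2_on U F \<longleftrightarrow>
     (\<forall>bs. continuous_on U (\<lambda>(e,t). pdiff bs F e t) \<and>
           (\<forall>(e,t)\<in>U. (\<lambda>e'. pdiff bs F e' t) differentiable (at e) \<and>
                       (\<lambda>t'. pdiff bs F e t') differentiable (at t)))"

text \<open>Equi-affine quantities of a plane curve t \<mapsto> (u t, v t) in an arbitrary
  (regular, nondegenerate) parameter t.  ds = sigma dt with sigma = |c',c''|^(1/3);
  tangent T = (dc/dt)/sigma, Blaschke normal N = (dT/dt)/sigma, and the equi-affine
  curvature kappa = |N, dN/ds| = |N, (dN/dt)/sigma|  (for arc-length parametrisation
  this is |gamma'',gamma'''| which equals kappa since gamma''' = -kappa gamma').\<close>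
definition ea_speed :: "(real \<Rightarrow> real) \<Rightarrow> (real \<Rightarrow> real) \<Rightarrow> real \<Rightarrow> real" where
  "ea_speed u v t = root 3 (det2 (deriv u t) (deriv v t) (deriv (deriv u) t) (deriv (deriv v) t))"

definition ea_tangent_x :: "(real \<Rightarrow> real) \<Rightarrow> (real \<Rightarrow> real) \<Rightarrow> real \<Rightarrow> real" where
  "ea_tangent_x u v t = deriv u t / ea_speed u v t"

definition ea_tangent_y :: "(real \<Rightarrow> real) \<Rightarrow> (real \<Rightarrow> real) \<Rightarrow> real \<Rightarrow> real" where
  "ea_tangent_y u v t = deriv v t / ea_speed u v t"

definition ea_normal_x :: "(real \<Rightarrow> real) \<Rightarrow> (real \<Rightarrow> real) \<Rightarrow> real \<Rightarrow> real" where
  "ea_normal_x u v t = deriv (ea_tangent_x u v) t / ea_speed u v t"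

definition ea_normal_y :: "(real \<Rightarrow> real) \<Rightarrow> (real \<Rightarrow> real) \<Rightarrow> real \<Rightarrow> real" where
  "ea_normal_y u v t = deriv (ea_tangent_y u v) t / ea_speed u v t"

definition ea_curvature :: "(real \<Rightarrow> real) \<Rightarrow> (real \<Rightarrow> real) \<Rightarrow> real \<Rightarrow> real" where
  "ea_curvature u v t =
     det2 (ea_normal_x u v t) (ea_normal_y u v t)
          (deriv (ea_normal_x u v) t / ea_speed u v t) (deriv (ea_normal_y u v) t / ea_speed u v t)"

definition total_ea_curvature :: "real \<Rightarrow> real \<Rightarrow> (real \<Rightarrow> real) \<Rightarrow> (real \<Rightarrow> real) \<Rightarrow> real" where
  "total_ea_curvature a b u v = integral {a..b} (\<lambda>t. ea_curvature u v t * ea_speed u v t)"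

text \<open>Critical point of the total equi-affine curvature with respect to smooth
  compactly supported variations (X e, Y e) of the curve (x,y) defined on I:
  the variation is fixed outside a compact [a,b] \<subseteq> I, so the first variation of
  the functional is the derivative at e = 0 of the functional over [a,b].\<close>
definition ea_total_curvature_critical :: "real set \<Rightarrow> (real \<Rightarrow> real) \<Rightarrow> (real \<Rightarrow> real) \<Rightarrow> bool" where
  "ea_total_curvature_critical I x y \<longleftrightarrow>
     (\<forall>X Y \<delta> a b.
        0 < \<delta> \<and> a \<le> b \<and> {a..b} \<subseteq> I \<and>
        smooth2_on ({-\<delta><..<\<delta>} \<times> I) X \<and> smooth2_on ({-\<delta><..<\<delta>} \<times> I) Y \<and>
        (\<forall>t\<in>I. X 0 t = x t \<and> Y 0 t = y t) \<and>
        (\<forall>e\<in>{-\<delta><..<\<delta>}. \<forall>t\<in>I - {a..b}. X e t = x t \<and> Y e t = y t)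
        \<longrightarrow> ((\<lambda>e. total_ea_curvature a b (X e) (Y e)) has_real_derivative 0) (at 0))"

end

theory Submission
  imports Defs
begin

text \<open>
  In an arbitrary parameter, with \<open>\<sigma> = |c',c''|\<^bsup>1/3\<^esup>\<close>, the curvature density is
  \<open>\<kappa>\<sigma> = |c'',c'''|/\<sigma>\<^sup>4 - \<sigma>'\<^sup>2/\<sigma>\<^sup>3 + (\<sigma>'/\<sigma>\<^sup>2)'\<close>. Compactly supported variations do not see the
  total derivative, and differentiating the remaining Lagrangian at an arc-length parametrised
  curve in the direction \<open>\<xi>\<close> gives, after integrations by parts, the first variation
  \<open>2/3 \<integral> (\<kappa>'' + \<kappa>\<^sup>2) |\<gamma>',\<xi>| ds\<close>. Hence the Euler--Lagrange equation is \<open>\<kappa>'' = -\<kappa>\<cdot>\<kappa>\<close>: the curvature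
  solves the same linear equation \<open>f'' = -\<kappa> f\<close> as \<open>x'\<close> and \<open>y'\<close>, which form a basis of its
  solutions since their Wronskian is \<open>1\<close>.
\<close>

subsection \<open>Smooth functions of one variable\<close>

text \<open>Derivatives are supplied as witnesses instead of through \<open>deriv\<close>, so that
  closure under sums and products is an induction with explicit derivatives and calls for no
  neighbourhood on which \<open>deriv\<close> is known.\<close>

fun n_diff_on :: "nat \<Rightarrow> real set \<Rightarrow> (real \<Rightarrow> real) \<Rightarrow> bool" where
  "n_diff_on 0 S f = True"
| "n_diff_on (Suc n) S f \<longleftrightarrow>
     (\<exists>f'. (\<forall>t\<in>S. (f has_real_derivative f' t) (at t)) \<and> n_diff_on n S f')"

lemma n_diff_on_Suc_imp: "n_diff_on (Suc n) S f \<Longrightarrow> n_diff_on n S f"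
proof (induction n arbitrary: f)
  case (Suc n)
  then obtain f' where "\<forall>t\<in>S. (f has_real_derivative f' t) (at t)" "n_diff_on (Suc n) S f'"
    by auto
  with Suc.IH[of f'] show ?case by auto
qed auto

lemma n_diff_on_cong:
  assumes "open S" "n_diff_on n S f" "\<And>t. t \<in> S \<Longrightarrow> f t = g t"
  shows "n_diff_on n S g"
proof (cases n)
  case (Suc m)
  then obtain f' where f': "\<forall>t\<in>S. (f has_real_derivative f' t) (at t)" "n_diff_on m S f'"
    using assms by auto
  have "\<forall>t\<in>S. (g has_real_derivative f' t) (at t)"
    using f'(1) assms by (metis has_field_derivative_transform_within_open)
  with f' Suc show ?thesis by auto
qed auto

lemma n_diff_on_const: "n_diff_on n S (\<lambda>t. c)"
proof (induction n arbitrary: c)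
  case (Suc n)
  have "\<forall>t\<in>S. ((\<lambda>t. c) has_real_derivative 0) (at t)" by simp
  with Suc.IH[of 0] show ?case by (auto intro: exI[of _ "\<lambda>_. 0"])
qed auto

lemma n_diff_on_add:
  "n_diff_on n S f \<Longrightarrow> n_diff_on n S g \<Longrightarrow> n_diff_on n S (\<lambda>t. f t + g t)"
proof (induction n arbitrary: f g)
  case (Suc n)
  then obtain f' g' where
    "\<forall>t\<in>S. (f has_real_derivative f' t) (at t)" "n_diff_on n S f'"
    "\<forall>t\<in>S. (g has_real_derivative g' t) (at t)" "n_diff_on n S g'"
    by auto
  then show ?case
    using Suc.IH[of f' g'] by (auto intro!: exI[of _ "\<lambda>t. f' t + g' t"] DERIV_add)
qed auto

lemma n_diff_on_mult:
  "n_diff_on n S f \<Longrightarrow> n_diff_on n S g \<Longrightarrow> n_diff_on n S (\<lambda>t. f t * g t)"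
proof (induction n arbitrary: f g)
  case (Suc n)
  then obtain f' g' where
    d: "\<forall>t\<in>S. (f has_real_derivative f' t) (at t)" "n_diff_on n S f'"
    "\<forall>t\<in>S. (g has_real_derivative g' t) (at t)" "n_diff_on n S g'"
    by auto
  have "n_diff_on n S (\<lambda>t. f' t * g t + g' t * f t)"
    using d n_diff_on_Suc_imp[OF Suc.prems(1)] n_diff_on_Suc_imp[OF Suc.prems(2)]
    by (intro n_diff_on_add Suc.IH)
  with d show ?case
    by (auto intro!: exI[of _ "\<lambda>t. f' t * g t + g' t * f t"] DERIV_mult)
qed auto

lemma n_diff_on_affine:
  "n_diff_on n UNIV f \<Longrightarrow> n_diff_on n S (\<lambda>t. f (c * t + d))"
proof (induction n arbitrary: f)
  case (Suc n)
  then obtain f' where f': "\<forall>t. (f has_real_derivative f' t) (at t)" "n_diff_on n UNIV f'"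
    by auto
  have "((\<lambda>t. f (c * t + d)) has_real_derivative (f' (c * t + d) * c)) (at t)" for t
    by (rule DERIV_chain2[where f = f]) (auto simp: f' intro!: derivative_eq_intros)
  moreover have "n_diff_on n S (\<lambda>t. f' (c * t + d) * c)"
    by (intro n_diff_on_mult n_diff_on_const Suc.IH f')
  ultimately show ?case by (auto intro!: exI[of _ "\<lambda>t. f' (c * t + d) * c"])
qed auto

lemma smooth1_on_DERIV:
  assumes "smooth1_on S f" "t \<in> S"
  shows "((deriv ^^ n) f has_real_derivative (deriv ^^ Suc n) f t) (at t)"
proof -
  have "(deriv ^^ n) f differentiable (at t)"
    using assms by (auto simp: smooth1_on_def)
  then show ?thesis
    using DERIV_deriv_iff_real_differentiable by fastforce
qed

text \<open>Bridges the two forms of smoothness. One way, the iterates of \<open>deriv\<close> are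
  the witnesses; the other way, \<open>deriv g\<close> equals a witness only on \<open>S\<close>,
  and openness lets this equality be differentiated again.\<close>

lemma smooth1_on_iff_n_diff_on:
  assumes "open S"
  shows "smooth1_on S f \<longleftrightarrow> (\<forall>n. n_diff_on n S f)"
proof
  assume f: "smooth1_on S f"
  have "n_diff_on n S ((deriv ^^ m) f)" for n m
  proof (induction n arbitrary: m)
    case (Suc n)
    then show ?case
      using smooth1_on_DERIV[OF f] by (auto intro!: exI[of _ "(deriv ^^ Suc m) f"] simp del: funpow.simps)
  qed auto
  from this[of _ 0] show "\<forall>n. n_diff_on n S f" by simp
next
  assume f: "\<forall>n. n_diff_on n S f"
  have "n_diff_on (Suc n) S g \<Longrightarrow> \<forall>t\<in>S. (deriv ^^ n) g differentiable (at t)" for n g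
  proof (induction n arbitrary: g)
    case 0
    then show ?case by (auto simp: real_differentiable_def)
  next
    case (Suc n)
    then obtain g' where g': "\<forall>t\<in>S. (g has_real_derivative g' t) (at t)" "n_diff_on (Suc n) S g'"
      by auto
    then have "n_diff_on (Suc n) S (deriv g)"
      by (metis n_diff_on_cong[OF assms] DERIV_imp_deriv)
    from Suc.IH[OF this] show ?case by (simp add: funpow_Suc_right del: funpow.simps)
  qed
  with f show "smooth1_on S f" unfolding smooth1_on_def by blast
qed

section \<open>Flat functions and bump functions\<close>

definition flat_exp :: "nat \<Rightarrow> real \<Rightarrow> real" where
  "flat_exp k t = (if t \<le> 0 then 0 else inverse t ^ k / exp (inverse t))"

text \<open>For \<open>t > 0\<close> this is the product rule; at \<open>0\<close> the right
  difference quotient is \<open>flat_exp (k + 1)\<close>, which tends to \<open>0\<close> because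
  the exponential outgrows every power. The index \<open>k\<close> closes the family under
  differentiation up to linear combinations, so smoothness follows by induction.\<close>

lemma DERIV_flat_exp:
  "(flat_exp k has_real_derivative (flat_exp (k + 2) t - k * flat_exp (k + 1) t)) (at t)"
proof -
  consider "t < 0" | "t > 0" | "t = 0" by linarith
  then show ?thesis
  proof cases
    case 1
    have "((\<lambda>_. 0) has_real_derivative 0) (at t)" by simp
    then have "(flat_exp k has_real_derivative 0) (at t)"
      by (rule has_field_derivative_transform_within_open[where S = "{..<0}"])
         (use 1 in \<open>auto simp: flat_exp_def\<close>)
    with 1 show ?thesis by (simp add: flat_exp_def)
  next
    case 2
    have "((\<lambda>t. inverse t ^ k) has_real_derivative - (k * inverse t ^ (k + 1))) (at t)"
      using DERIV_power[OF DERIV_inverse[of t UNIV], of k] 2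
      by (cases k) (simp_all add: numeral_2_eq_2 mult_ac)
    moreover have "((\<lambda>t. exp (- inverse t)) has_real_derivative exp (- inverse t) * inverse t ^ 2) (at t)"
      using 2 by (auto intro!: derivative_eq_intros) (simp only: power2_eq_square)
    ultimately have "((\<lambda>t. inverse t ^ k * exp (- inverse t)) has_real_derivative
        - (k * inverse t ^ (k + 1)) * exp (- inverse t)
        + exp (- inverse t) * inverse t ^ 2 * inverse t ^ k) (at t)"
      by (rule DERIV_mult)
    also have "- (k * inverse t ^ (k + 1)) * exp (- inverse t)
        + exp (- inverse t) * inverse t ^ 2 * inverse t ^ k
        = flat_exp (k + 2) t - k * flat_exp (k + 1) t"
      using 2 by (simp add: flat_exp_def exp_minus divide_inverse power_add power2_eq_square)
    finally have "((\<lambda>t. inverse t ^ k * exp (- inverse t)) has_real_derivative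
        (flat_exp (k + 2) t - k * flat_exp (k + 1) t)) (at t)" .
    then show ?thesis
      by (rule has_field_derivative_transform_within_open[where S = "{0<..}"])
         (use 2 in \<open>auto simp: flat_exp_def exp_minus field_simps\<close>)
  next
    case 3
    have "((\<lambda>h. inverse h ^ (k + 1) / exp (inverse h)) \<longlongrightarrow> (0::real)) (at_right 0)"
      by (rule filterlim_compose[OF tendsto_power_div_exp_0 filterlim_inverse_at_top_right])
    then have "((\<lambda>h. flat_exp k h / h) \<longlongrightarrow> 0) (at_right 0)"
      by (rule Lim_transform_eventually)
        (auto simp: eventually_at_filter flat_exp_def field_simps)
    moreover have "((\<lambda>h. flat_exp k h / h) \<longlongrightarrow> 0) (at_left 0)"
      by (rule Lim_transform_eventually[OF tendsto_const])
        (auto simp: eventually_at_filter flat_exp_def)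
    ultimately have "((\<lambda>h. flat_exp k h / h) \<longlongrightarrow> 0) (at 0)"
      by (simp add: filterlim_split_at)
    then show ?thesis using 3 by (simp add: DERIV_def flat_exp_def)
  qed
qed

lemma n_diff_on_flat_exp: "n_diff_on n S (flat_exp k)"
proof (induction n arbitrary: k)
  case (Suc n)
  have "n_diff_on n S (\<lambda>t. flat_exp (k + 2) t + (- real k) * flat_exp (k + 1) t)"
    by (intro n_diff_on_add n_diff_on_mult n_diff_on_const Suc.IH)
  then show ?case
    using DERIV_flat_exp[of k]
    by (auto intro!: exI[of _ "\<lambda>t. flat_exp (k + 2) t + (- real k) * flat_exp (k + 1) t"])
qed auto

text \<open>The bump is a product of two flat functions, one vanishing to the left of
  \<open>a\<close>, the other to the right of \<open>b\<close>.\<close>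

lemma smooth_bump_exists:
  fixes a b :: real
  obtains \<phi> :: "real \<Rightarrow> real" where "\<And>n S. n_diff_on n S \<phi>" "\<And>t. a < t \<Longrightarrow> t < b \<Longrightarrow> \<phi> t > 0"
    "\<And>t. t \<le> a \<or> b \<le> t \<Longrightarrow> \<phi> t = 0"
proof
  \<comment> \<open>The coefficients \<open>1\<close> and \<open>- 1\<close> are spelled out to fit
    the pattern \<open>c * t + d\<close> of \<open>n_diff_on_affine\<close>.\<close>
  let ?\<phi> = "\<lambda>t. flat_exp 0 (1 * t + - a) * flat_exp 0 (- 1 * t + b)"
  show "n_diff_on n S ?\<phi>" for n S
    by (intro n_diff_on_mult n_diff_on_affine n_diff_on_flat_exp)
qed (auto simp: flat_exp_def)

subsection \<open>Smooth functions of two variables\<close>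

text \<open>Words act from the last letter to the first: \<open>pdiff [True, False]\<close>
  differentiates in the curve parameter \<open>t\<close> and then in the variation parameter
  \<open>e\<close>. Concatenating words composes the operators, hence every partial derivative of a
  smooth function is smooth.\<close>

lemma pdiff_append: "pdiff (bs @ cs) F = pdiff bs (pdiff cs F)"
proof (induction bs)
  case (Cons b bs)
  then show ?case by (cases b) simp_all
qed simp

lemma smooth2_on_pdiff: "smooth2_on U F \<Longrightarrow> smooth2_on U (pdiff cs F)"
  by (simp add: smooth2_on_def flip: pdiff_append)

lemma smooth2_on_DERIV_fst:
  assumes "smooth2_on U F" "(e, t) \<in> U"
  shows "((\<lambda>e. pdiff bs F e t) has_real_derivative pdiff (True # bs) F e t) (at e)"
proof -
  have "(\<lambda>e. pdiff bs F e t) differentiable (at e)"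
    using assms unfolding smooth2_on_def by blast
  then show ?thesis
    using DERIV_deriv_iff_real_differentiable by simp
qed

lemma smooth2_on_DERIV_snd:
  assumes "smooth2_on U F" "(e, t) \<in> U"
  shows "(pdiff bs F e has_real_derivative pdiff (False # bs) F e t) (at t)"
proof -
  have "pdiff bs F e differentiable (at t)"
    using assms unfolding smooth2_on_def by blast
  then show ?thesis
    using DERIV_deriv_iff_real_differentiable by simp
qed

lemma smooth2_on_continuous_on:
  assumes "smooth2_on U F"
  shows "continuous_on U (\<lambda>z. pdiff bs F (fst z) (snd z))"
  using assms unfolding smooth2_on_def case_prod_beta by blast

text \<open>Differentiating \<open>F e s - F e c = \<integral>\<^bsub>c\<^esub>\<^bsup>s\<^esup> F\<^sub>t\<close> first in \<open>e\<close> (under the integral), then in \<open>s\<close>.\<close>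

lemma smooth2_on_mixed_DERIV:
  assumes F: "smooth2_on (J \<times> I) F" and "open J" "open I" "e \<in> J" "t \<in> I"
  shows "((\<lambda>t. pdiff [True] F e t) has_real_derivative pdiff [True, False] F e t) (at t)"
proof -
  obtain r where r: "r > 0" "ball e r \<subseteq> J"
    using assms openE by blast
  obtain q where q: "q > 0" "cball t q \<subseteq> I"
    using assms open_contains_cball by blast
  \<comment> \<open>A compact interval around \<open>t\<close> inside \<open>I\<close>; its left end
    is the fixed lower limit of integration.\<close>
  define c d where "c = t - q" and "d = t + q"
  have cd: "c < t" "t < d" "{c..d} \<subseteq> I"
    using q by (auto simp: c_def d_def cball_eq_atLeastAtMost)
  have U: "(e', s) \<in> J \<times> I" if "e' \<in> ball e r" "s \<in> {c..d}" for e' s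
    using that r cd by auto
  have cont: "continuous_on (ball e r \<times> {c..d}) (\<lambda>z. pdiff bs F (fst z) (snd z))" for bs
    by (rule continuous_on_subset[OF smooth2_on_continuous_on[OF F]]) (use U in auto)
  have cont_t: "continuous_on {c..d} (pdiff bs F e)" for bs
    by (rule continuous_on_compose2[OF cont[of bs], of _ "\<lambda>s. (e, s)", simplified])
      (use r in \<open>auto intro!: continuous_intros\<close>)
  have ftc: "((\<lambda>s. pdiff [False] F e' s) has_integral (F e' s - F e' c)) {c..s}"
    if "e' \<in> ball e r" "s \<in> {c..d}" for e' s
  proof (rule fundamental_theorem_of_calculus)
    show "(F e' has_vector_derivative pdiff [False] F e' u) (at u within {c..s})"
      if "u \<in> {c..s}" for u
      using smooth2_on_DERIV_snd[OF F U, of e' u "[]"] that \<open>e' \<in> ball e r\<close> \<open>s \<in> {c..d}\<close>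
      by (auto simp: has_real_derivative_iff_has_vector_derivative
          intro: has_vector_derivative_at_within)
  qed (use that in auto)
  have eq: "pdiff [True] F e s = pdiff [True] F e c + integral {c..s} (pdiff [True, False] F e)"
    if s: "s \<in> {c..d}" for s
  proof -
    have "((\<lambda>e'. integral (cbox c s) (pdiff [False] F e')) has_real_derivative
        integral (cbox c s) (pdiff [True, False] F e)) (at e within ball e r)"
    proof (rule leibniz_rule_field_derivative)
      show "((\<lambda>e'. pdiff [False] F e' u) has_real_derivative pdiff [True, False] F e' u)
          (at e' within ball e r)" if "e' \<in> ball e r" "u \<in> cbox c s" for e' u
        using smooth2_on_DERIV_fst[OF F U, of e' u "[False]"] that s
        by (auto intro: has_field_derivative_at_within)
      show "pdiff [False] F e' integrable_on cbox c s" if "e' \<in> ball e r" for e'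
        using ftc[OF that s] by auto
      show "continuous_on (ball e r \<times> cbox c s) (\<lambda>(e, u). pdiff [True, False] F e u)"
        unfolding case_prod_beta
        by (rule continuous_on_subset[OF cont]) (use s in auto)
    qed (use r in auto)
    then have "((\<lambda>e'. integral {c..s} (pdiff [False] F e')) has_real_derivative
        integral {c..s} (pdiff [True, False] F e)) (at e)"
      using r by (simp add: at_within_open[of e "ball e r"])
    then have "((\<lambda>e'. F e' s - F e' c) has_real_derivative
        integral {c..s} (pdiff [True, False] F e)) (at e)"
      by (rule has_field_derivative_transform_within_open[where S = "ball e r"])
        (use r ftc s in \<open>auto intro!: integral_unique\<close>)
    \<comment> \<open>The same derivative in \<open>e\<close>, now taken term by term; uniqueness of
      derivatives equates it with the integral.\<close>
    moreover have "((\<lambda>e'. F e' s - F e' c) has_real_derivative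
        pdiff [True] F e s - pdiff [True] F e c) (at e)"
      using smooth2_on_DERIV_fst[OF F U, of e s "[]"] smooth2_on_DERIV_fst[OF F U, of e c "[]"] r s
      by (intro DERIV_diff) auto
    ultimately have "integral {c..s} (pdiff [True, False] F e) = pdiff [True] F e s - pdiff [True] F e c"
      by (rule DERIV_unique)
    then show ?thesis by linarith
  qed
  \<comment> \<open>Up to a constant, the \<open>e\<close>-derivative of \<open>F\<close> is by now
    an integral of a continuous function with variable upper limit, which the fundamental theorem
    differentiates in \<open>s\<close>.\<close>
  have "((\<lambda>s. integral {c..s} (pdiff [True, False] F e)) has_real_derivative
      pdiff [True, False] F e t) (at t within {c..d})"
    by (rule integral_has_real_derivative)
      (use cont_t[of "[True, False]"] cd in \<open>auto simp del: pdiff.simps\<close>)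
  then have "((\<lambda>s. integral {c..s} (pdiff [True, False] F e)) has_real_derivative
      pdiff [True, False] F e t) (at t)"
    using cd at_within_interior[of t "{c..d}"] by simp
  from DERIV_add[OF DERIV_const[of "pdiff [True] F e c"] this]
  have "((\<lambda>s. pdiff [True] F e c + integral {c..s} (pdiff [True, False] F e))
      has_real_derivative pdiff [True, False] F e t) (at t)"
    by (simp only: add_0)
  then show ?thesis
    by (rule has_field_derivative_transform_within_open[where S = "{c<..<d}"])
      (use cd in \<open>auto intro!: eq[symmetric] simp del: pdiff.simps\<close>)
qed

section \<open>Variations affine in the parameter\<close>

lemma smooth1_on_imp_continuous_on:
  assumes "smooth1_on S f"
  shows "continuous_on S f"
proof (rule DERIV_continuous_on, rule has_field_derivative_at_within)
  show "(f has_real_derivative deriv f t) (at t)" if "t \<in> S" for t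
    using smooth1_on_DERIV[OF assms that, of 0] by simp
qed

lemma smooth1_on_deriv:
  assumes "smooth1_on S f"
  shows "smooth1_on S (deriv f)"
  unfolding smooth1_on_def
proof (intro allI ballI)
  fix n t assume "t \<in> S"
  with assms have "(deriv ^^ Suc n) f differentiable (at t)"
    unfolding smooth1_on_def by blast
  then show "(deriv ^^ n) (deriv f) differentiable (at t)"
    by (simp add: funpow_Suc_right del: funpow.simps)
qed

text \<open>Each partial derivative is again affine in \<open>e\<close> with smooth coefficients:
  differentiating in \<open>t\<close> acts on the coefficients, differentiating in \<open>e\<close>
  leaves the slope as the new constant term. The test variations are of this shape.\<close>

lemma smooth2_on_linear:
  assumes "open J" "open I" and f: "smooth1_on I f" and g: "smooth1_on I g"
  shows "smooth2_on (J \<times> I) (\<lambda>e t. f t + e * g t)"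
proof -
  define F where "F e t = f t + e * g t" for e t
  \<comment> \<open>\<open>G\<close> stands for an iterated partial derivative, known to be affine
    only on \<open>J \<times> I\<close>; openness of both factors lets the formula be
    differentiated.\<close>
  have DERIV_affine: "((\<lambda>e. G e t) has_real_derivative B t) (at e)"
    "(G e has_real_derivative deriv A t + e * deriv B t) (at t)"
    if "smooth1_on I A" "smooth1_on I B" and G: "\<forall>e\<in>J. \<forall>t\<in>I. G e t = A t + e * B t"
      and "e \<in> J" "t \<in> I" for A B G e t
  proof -
    have "((\<lambda>e. A t + e * B t) has_real_derivative B t) (at e)"
      by (auto intro!: derivative_eq_intros)
    then show "((\<lambda>e. G e t) has_real_derivative B t) (at e)"
      by (rule has_field_derivative_transform_within_open[OF _ \<open>open J\<close> \<open>e \<in> J\<close>])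
        (simp add: G \<open>t \<in> I\<close>)
    have "((\<lambda>t. A t + e * B t) has_real_derivative deriv A t + e * deriv B t) (at t)"
      using smooth1_on_DERIV[OF that(1) \<open>t \<in> I\<close>, of 0] smooth1_on_DERIV[OF that(2) \<open>t \<in> I\<close>, of 0]
      by (intro DERIV_add DERIV_cmult) simp_all
    then show "(G e has_real_derivative deriv A t + e * deriv B t) (at t)"
      by (rule has_field_derivative_transform_within_open[OF _ \<open>open I\<close> \<open>t \<in> I\<close>])
        (simp add: G \<open>e \<in> J\<close>)
  qed
  have affine: "\<exists>A B. smooth1_on I A \<and> smooth1_on I B \<and>
      (\<forall>e\<in>J. \<forall>t\<in>I. pdiff bs F e t = A t + e * B t)" for bs
  proof (induction bs)
    case Nil
    then show ?case using f g by (auto simp: F_def)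
  next
    case (Cons c bs)
    then obtain A B where AB: "smooth1_on I A" "smooth1_on I B"
      "\<forall>e\<in>J. \<forall>t\<in>I. pdiff bs F e t = A t + e * B t"
      by blast
    note d = DERIV_affine[OF AB, THEN DERIV_imp_deriv]
    show ?case
    proof (cases c)
      case True
      have "smooth1_on I (\<lambda>_. 0)"
        by (simp add: smooth1_on_iff_n_diff_on[OF \<open>open I\<close>] n_diff_on_const)
      with AB(2) d(1) True show ?thesis
        by (intro exI[of _ B] exI[of _ "\<lambda>_. 0"]) simp
    next
      case False
      with smooth1_on_deriv[OF AB(1)] smooth1_on_deriv[OF AB(2)] d(2) show ?thesis
        by (intro exI[of _ "deriv A"] exI[of _ "deriv B"]) simp
    qed
  qed
  have "continuous_on (J \<times> I) (\<lambda>(e, t). pdiff bs F e t)" for bs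
  proof -
    obtain A B where AB: "smooth1_on I A" "smooth1_on I B"
      "\<forall>e\<in>J. \<forall>t\<in>I. pdiff bs F e t = A t + e * B t"
      using affine[of bs] by blast
    have "continuous_on (J \<times> I) (\<lambda>z. h (snd z))" if "smooth1_on I h" for h
      by (rule continuous_on_compose2[OF smooth1_on_imp_continuous_on[OF that]])
        (auto intro: continuous_on_snd continuous_on_id)
    then have "continuous_on (J \<times> I) (\<lambda>z. A (snd z) + fst z * B (snd z))"
      using AB by (intro continuous_on_add continuous_on_mult continuous_on_fst continuous_on_id)
    then show ?thesis
      by (rule continuous_on_eq) (use AB(3) in force)
  qed
  moreover have "(\<lambda>e. pdiff bs F e t) differentiable (at e) \<and> pdiff bs F e differentiable (at t)"
    if "e \<in> J" "t \<in> I" for bs e t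
  proof -
    obtain A B where AB: "smooth1_on I A" "smooth1_on I B"
      "\<forall>e\<in>J. \<forall>t\<in>I. pdiff bs F e t = A t + e * B t"
      using affine[of bs] by blast
    from DERIV_affine[OF AB that] show ?thesis
      unfolding real_differentiable_def by blast
  qed
  ultimately have "smooth2_on (J \<times> I) F"
    unfolding smooth2_on_def by blast
  then show ?thesis unfolding F_def[abs_def] .
qed

subsection \<open>The curvature density\<close>

lemma DERIV_root3:
  assumes "(f has_real_derivative f') (at x)" "f x \<noteq> 0"
  shows "((\<lambda>x. root 3 (f x)) has_real_derivative f' / (3 * root 3 (f x) ^ 2)) (at x)"
proof -
  have "(root 3 has_real_derivative inverse (real 3 * root 3 (f x) ^ (3 - Suc 0))) (at (f x))"
    by (rule DERIV_odd_real_root) (use assms in auto)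
  from DERIV_chain2[OF this assms(1)] show ?thesis
    by (simp add: field_simps)
qed

text \<open>This is \<open>\<sigma>'/\<sigma>^2\<close>, because differentiating
  \<open>\<sigma>^3 = |c',c''|\<close> gives \<open>3 \<sigma>^2 \<sigma>' = |c',c'''|\<close>. It
  is a function of the jet, so that it applies to every curve of a variation.\<close>

definition ea_boundary :: "real \<Rightarrow> real \<Rightarrow> real \<Rightarrow> real \<Rightarrow> real \<Rightarrow> real \<Rightarrow> real" where
  "ea_boundary u1 v1 u2 v2 u3 v3 = det2 u1 v1 u3 v3 / (3 * root 3 (det2 u1 v1 u2 v2) ^ 4)"

text \<open>This is \<open>|c'',c'''|/\<sigma>^4 - \<sigma>'^2/\<sigma>^3\<close> with
  \<open>\<sigma>'\<close> eliminated. It involves three derivatives of the curve, one fewer than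
  the curvature density.\<close>

definition ea_lagrangian :: "real \<Rightarrow> real \<Rightarrow> real \<Rightarrow> real \<Rightarrow> real \<Rightarrow> real \<Rightarrow> real" where
  "ea_lagrangian u1 v1 u2 v2 u3 v3 =
     det2 u2 v2 u3 v3 / root 3 (det2 u1 v1 u2 v2) ^ 4
     - det2 u1 v1 u3 v3 ^ 2 / (9 * root 3 (det2 u1 v1 u2 v2) ^ 7)"

text \<open>With \<open>H = |c',c'''|\<close> the density is \<open>|c'',c'''|/\<sigma>^4 + H'/(3
  \<sigma>^4) - 5 H^2/(9 \<sigma>^7)\<close>, while \<open>H/(3 \<sigma>^4)\<close> has derivative
  \<open>H'/(3 \<sigma>^4) - 4 H^2/(9 \<sigma>^7)\<close>. The fourth derivatives, which occur only
  in \<open>H'\<close>, cancel in the difference.\<close>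

lemma ea_curvature_density:
  assumes "open S" "t \<in> S"
    and u: "\<And>t. t \<in> S \<Longrightarrow> (u has_real_derivative u1 t) (at t)"
      "\<And>t. t \<in> S \<Longrightarrow> (u1 has_real_derivative u2 t) (at t)"
      "\<And>t. t \<in> S \<Longrightarrow> (u2 has_real_derivative u3 t) (at t)"
      "\<And>t. t \<in> S \<Longrightarrow> (u3 has_real_derivative u4 t) (at t)"
    and v: "\<And>t. t \<in> S \<Longrightarrow> (v has_real_derivative v1 t) (at t)"
      "\<And>t. t \<in> S \<Longrightarrow> (v1 has_real_derivative v2 t) (at t)"
      "\<And>t. t \<in> S \<Longrightarrow> (v2 has_real_derivative v3 t) (at t)"
      "\<And>t. t \<in> S \<Longrightarrow> (v3 has_real_derivative v4 t) (at t)"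
    and D: "\<And>t. t \<in> S \<Longrightarrow> det2 (u1 t) (v1 t) (u2 t) (v2 t) > 0"
  shows "((\<lambda>t. ea_boundary (u1 t) (v1 t) (u2 t) (v2 t) (u3 t) (v3 t)) has_real_derivative
    ea_curvature u v t * ea_speed u v t
    - ea_lagrangian (u1 t) (v1 t) (u2 t) (v2 t) (u3 t) (v3 t)) (at t)"
proof -
  define \<sigma> where "\<sigma> t = root 3 (det2 (u1 t) (v1 t) (u2 t) (v2 t))" for t
  \<comment> \<open>The derivative of \<open>\<sigma>^3\<close>; the other term of the product rule
    is |c'',c''|, which is zero.\<close>
  define H where "H t = det2 (u1 t) (v1 t) (u3 t) (v3 t)" for t
  define H' where "H' t = det2 (u2 t) (v2 t) (u3 t) (v3 t) + det2 (u1 t) (v1 t) (u4 t) (v4 t)" for t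
  have \<sigma>0: "\<sigma> t > 0" if "t \<in> S" for t
    using D[OF that] by (simp add: \<sigma>_def)
  have nz: "\<sigma> t ^ 2 \<noteq> 0" "3 * \<sigma> t ^ 5 \<noteq> 0" "3 * \<sigma> t ^ 4 \<noteq> 0" if "t \<in> S" for t
    using \<sigma>0[OF that] by auto
  have \<sigma>3: "\<sigma> t ^ 3 = u1 t * v2 t - v1 t * u2 t" if "t \<in> S" for t
    using D[OF that] by (simp add: \<sigma>_def det2_def)
  have dH: "(H has_real_derivative H' t) (at t)" if "t \<in> S" for t
    unfolding H_def[abs_def] H'_def det2_def
    by (rule derivative_eq_intros u v that refl)+ (simp add: algebra_simps)
  have d\<sigma>: "(\<sigma> has_real_derivative H t / (3 * \<sigma> t ^ 2)) (at t)" if "t \<in> S" for t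
  proof -
    have "((\<lambda>t. det2 (u1 t) (v1 t) (u2 t) (v2 t)) has_real_derivative H t) (at t)"
      unfolding H_def det2_def
      by (rule derivative_eq_intros u v that refl)+ (simp add: algebra_simps)
    from DERIV_root3[OF this] D[OF that] show ?thesis
      by (simp add: \<sigma>_def[abs_def])
  qed
  have deriv1: "deriv u t = u1 t" "deriv v t = v1 t" if "t \<in> S" for t
    using u(1) v(1) that by (auto intro: DERIV_imp_deriv)
  have deriv2: "deriv (deriv u) t = u2 t" "deriv (deriv v) t = v2 t" if "t \<in> S" for t
    using has_field_derivative_transform_within_open[OF u(2)[OF that] \<open>open S\<close> that]
      has_field_derivative_transform_within_open[OF v(2)[OF that] \<open>open S\<close> that] deriv1
    by (auto intro!: DERIV_imp_deriv)
  have speed: "ea_speed u v t = \<sigma> t" if "t \<in> S" for t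
    using that by (simp add: ea_speed_def \<sigma>_def deriv1 deriv2)
  \<comment> \<open>One coordinate of the Blaschke normal, for a generic coordinate \<open>w\<close>
    so that the computation serves both \<open>u\<close> and \<open>v\<close>.\<close>
  have normal: "(deriv (\<lambda>t. deriv w t / ea_speed u v t) t) / ea_speed u v t
      = w2 t / \<sigma> t ^ 2 - H t * w1 t / (3 * \<sigma> t ^ 5)"
    if "t \<in> S" "\<And>t. t \<in> S \<Longrightarrow> deriv w t = w1 t"
      "\<And>t. t \<in> S \<Longrightarrow> (w1 has_real_derivative w2 t) (at t)" for w w1 w2 t
  proof -
    have "((\<lambda>t. w1 t / \<sigma> t) has_real_derivative
        (w2 t * \<sigma> t - w1 t * (H t / (3 * \<sigma> t ^ 2))) / (\<sigma> t * \<sigma> t)) (at t)"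
      using that \<sigma>0[OF that(1)] by (intro DERIV_divide d\<sigma>) auto
    then have "((\<lambda>t. deriv w t / ea_speed u v t) has_real_derivative
        (w2 t * \<sigma> t - w1 t * (H t / (3 * \<sigma> t ^ 2))) / (\<sigma> t * \<sigma> t)) (at t)"
      by (rule has_field_derivative_transform_within_open[OF _ \<open>open S\<close>])
        (use that speed in auto)
    from DERIV_imp_deriv[OF this] show ?thesis
      using \<sigma>0[OF that(1)] that(1)
      by (simp add: speed field_simps power2_eq_square eval_nat_numeral)
  qed
  have normal': "deriv (\<lambda>t. deriv (\<lambda>t. deriv w t / ea_speed u v t) t / ea_speed u v t) t
      = w3 t / \<sigma> t ^ 2 - H t * w2 t / \<sigma> t ^ 5
        - H' t * w1 t / (3 * \<sigma> t ^ 5) + 5 * H t ^ 2 * w1 t / (9 * \<sigma> t ^ 8)"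
    if "t \<in> S" "\<And>t. t \<in> S \<Longrightarrow> deriv w t = w1 t"
      "\<And>t. t \<in> S \<Longrightarrow> (w1 has_real_derivative w2 t) (at t)"
      "\<And>t. t \<in> S \<Longrightarrow> (w2 has_real_derivative w3 t) (at t)" for w w1 w2 w3 t
  proof -
    have "((\<lambda>t. w2 t / \<sigma> t ^ 2 - H t * w1 t / (3 * \<sigma> t ^ 5)) has_real_derivative
        w3 t / \<sigma> t ^ 2 - H t * w2 t / \<sigma> t ^ 5
        - H' t * w1 t / (3 * \<sigma> t ^ 5) + 5 * H t ^ 2 * w1 t / (9 * \<sigma> t ^ 8)) (at t)"
      apply (rule derivative_eq_intros that d\<sigma> dH nz refl)+
      using \<sigma>0[OF that(1)]
      by (simp_all add: divide_simps) (simp add: algebra_simps eval_nat_numeral)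
    then have "((\<lambda>t. deriv (\<lambda>t. deriv w t / ea_speed u v t) t / ea_speed u v t) has_real_derivative
        w3 t / \<sigma> t ^ 2 - H t * w2 t / \<sigma> t ^ 5
        - H' t * w1 t / (3 * \<sigma> t ^ 5) + 5 * H t ^ 2 * w1 t / (9 * \<sigma> t ^ 8)) (at t)"
      by (rule has_field_derivative_transform_within_open[OF _ \<open>open S\<close> that(1)])
        (use normal[OF _ that(2) that(3)] in auto)
    then show ?thesis by (rule DERIV_imp_deriv)
  qed
  define s where "s = \<sigma> t"
  have s: "s > 0" "s ^ 3 = u1 t * v2 t - v1 t * u2 t"
    using \<sigma>0 \<sigma>3 \<open>t \<in> S\<close> by (auto simp: s_def)
  note unf = ea_normal_x_def[abs_def] ea_normal_y_def[abs_def]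
    ea_tangent_x_def[abs_def] ea_tangent_y_def[abs_def]
  have N: "ea_normal_x u v t = u2 t / s ^ 2 - H t * u1 t / (3 * s ^ 5)"
    "ea_normal_y u v t = v2 t / s ^ 2 - H t * v1 t / (3 * s ^ 5)"
    unfolding unf s_def
    by (rule normal[OF \<open>t \<in> S\<close> deriv1(1) u(2)]; assumption)
      (rule normal[OF \<open>t \<in> S\<close> deriv1(2) v(2)]; assumption)
  have N': "deriv (ea_normal_x u v) t = u3 t / s ^ 2 - H t * u2 t / s ^ 5
        - H' t * u1 t / (3 * s ^ 5) + 5 * H t ^ 2 * u1 t / (9 * s ^ 8)"
    "deriv (ea_normal_y u v) t = v3 t / s ^ 2 - H t * v2 t / s ^ 5
        - H' t * v1 t / (3 * s ^ 5) + 5 * H t ^ 2 * v1 t / (9 * s ^ 8)"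
    unfolding unf s_def
    by (rule normal'[OF \<open>t \<in> S\<close> deriv1(1) u(2) u(3)]; assumption)
      (rule normal'[OF \<open>t \<in> S\<close> deriv1(2) v(2) v(3)]; assumption)
  \<comment> \<open>The speed cancels the division in the arc-length derivative of \<open>N\<close>,
    leaving \<open>|N, dN/dt|\<close>.\<close>
  have "ea_curvature u v t * ea_speed u v t
    = det2 (ea_normal_x u v t) (ea_normal_y u v t) (deriv (ea_normal_x u v) t) (deriv (ea_normal_y u v) t)"
    using s(1) speed[OF \<open>t \<in> S\<close>]
    by (simp add: ea_curvature_def det2_def left_diff_distrib flip: s_def)
  also have "\<dots> = det2 (u2 t / s ^ 2 - H t * u1 t / (3 * s ^ 5)) (v2 t / s ^ 2 - H t * v1 t / (3 * s ^ 5))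
      (u3 t / s ^ 2 - H t * u2 t / s ^ 5 - H' t * u1 t / (3 * s ^ 5) + 5 * H t ^ 2 * u1 t / (9 * s ^ 8))
      (v3 t / s ^ 2 - H t * v2 t / s ^ 5 - H' t * v1 t / (3 * s ^ 5) + 5 * H t ^ 2 * v1 t / (9 * s ^ 8))"
    unfolding N N' ..
  also have "\<dots> = det2 (u2 t) (v2 t) (u3 t) (v3 t) / s ^ 4
      + (u1 t * v2 t - v1 t * u2 t) * H' t / (3 * s ^ 7)
      - 5 * H t ^ 2 * (u1 t * v2 t - v1 t * u2 t) / (9 * s ^ 10)
      - H t * (u1 t * v3 t - v1 t * u3 t) / (3 * s ^ 7)
      + H t ^ 2 * (u1 t * v2 t - v1 t * u2 t) / (3 * s ^ 10)"
    using s(1) unfolding det2_def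
    by (simp add: divide_simps) (simp add: algebra_simps eval_nat_numeral)
  \<comment> \<open>Substituting \<open>s^3\<close> for |c',c''| and \<open>H\<close> for |c',c'''|
    makes the last two terms cancel.\<close>
  also have "\<dots> = det2 (u2 t) (v2 t) (u3 t) (v3 t) / s ^ 4 + H' t / (3 * s ^ 4) - 5 * H t ^ 2 / (9 * s ^ 7)"
    using s(1) unfolding s(2)[symmetric] det2_def H_def[of t]
    by (simp add: divide_simps) (simp add: algebra_simps eval_nat_numeral)
  finally have *: "ea_curvature u v t * ea_speed u v t = \<dots>" .
  have "((\<lambda>t. H t / (3 * \<sigma> t ^ 4)) has_real_derivative H' t / (3 * s ^ 4) - 4 * H t ^ 2 / (9 * s ^ 7)) (at t)"
    apply (rule derivative_eq_intros d\<sigma> dH nz refl \<open>t \<in> S\<close>)+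
    using s(1)
    by (simp_all add: divide_simps flip: s_def) (simp add: algebra_simps eval_nat_numeral)
  moreover have "H' t / (3 * s ^ 4) - 4 * H t ^ 2 / (9 * s ^ 7) = ea_curvature u v t * ea_speed u v t
    - ea_lagrangian (u1 t) (v1 t) (u2 t) (v2 t) (u3 t) (v3 t)"
    using s(1) unfolding * ea_lagrangian_def by (simp add: \<sigma>_def[symmetric] H_def[symmetric] s_def[symmetric])
  ultimately show ?thesis
    by (simp add: ea_boundary_def \<sigma>_def H_def)
qed

text \<open>The differential of \<open>ea_lagrangian\<close> at the jet \<open>(u, v)\<close> in the
  direction \<open>(p, q)\<close>. Since \<open>\<sigma>\<close> varies by
  \<open>1/(3 \<sigma>^2)\<close> times the variation of |c',c''|, the powers
  \<open>\<sigma>^4\<close> and \<open>\<sigma>^7\<close> in the denominators produce the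
  coefficients 4/3 and 7/27.\<close>

definition ea_lagrangian_deriv ::
  "real \<Rightarrow> real \<Rightarrow> real \<Rightarrow> real \<Rightarrow> real \<Rightarrow> real \<Rightarrow> real \<Rightarrow> real \<Rightarrow> real \<Rightarrow> real \<Rightarrow> real \<Rightarrow> real \<Rightarrow> real" where
  "ea_lagrangian_deriv u1 v1 u2 v2 u3 v3 p1 q1 p2 q2 p3 q3 =
     (det2 p2 q2 u3 v3 + det2 u2 v2 p3 q3) / root 3 (det2 u1 v1 u2 v2) ^ 4
     - 4 * det2 u2 v2 u3 v3 * (det2 p1 q1 u2 v2 + det2 u1 v1 p2 q2)
        / (3 * root 3 (det2 u1 v1 u2 v2) ^ 7)
     - 2 * det2 u1 v1 u3 v3 * (det2 p1 q1 u3 v3 + det2 u1 v1 p3 q3)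
        / (9 * root 3 (det2 u1 v1 u2 v2) ^ 7)
     + 7 * det2 u1 v1 u3 v3 ^ 2 * (det2 p1 q1 u2 v2 + det2 u1 v1 p2 q2)
        / (27 * root 3 (det2 u1 v1 u2 v2) ^ 10)"

lemma DERIV_det2:
  assumes "(f has_real_derivative f') (at x)" "(g has_real_derivative g') (at x)"
    "(h has_real_derivative h') (at x)" "(k has_real_derivative k') (at x)"
  shows "((\<lambda>x. det2 (f x) (g x) (h x) (k x)) has_real_derivative
    det2 f' g' (h x) (k x) + det2 (f x) (g x) h' k') (at x)"
  unfolding det2_def
  by (rule derivative_eq_intros assms refl)+ (simp add: algebra_simps)

lemma continuous_on_det2 [continuous_intros]:
  assumes "continuous_on S f" "continuous_on S g" "continuous_on S h" "continuous_on S k"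
  shows "continuous_on S (\<lambda>z. det2 (f z) (g z) (h z) (k z))"
  unfolding det2_def by (intro continuous_intros assms)

lemma DERIV_ea_lagrangian:
  assumes "(u1 has_real_derivative p1) (at e)" "(v1 has_real_derivative q1) (at e)"
    "(u2 has_real_derivative p2) (at e)" "(v2 has_real_derivative q2) (at e)"
    "(u3 has_real_derivative p3) (at e)" "(v3 has_real_derivative q3) (at e)"
    and "det2 (u1 e) (v1 e) (u2 e) (v2 e) > 0"
  shows "((\<lambda>e. ea_lagrangian (u1 e) (v1 e) (u2 e) (v2 e) (u3 e) (v3 e)) has_real_derivative
    ea_lagrangian_deriv (u1 e) (v1 e) (u2 e) (v2 e) (u3 e) (v3 e) p1 q1 p2 q2 p3 q3) (at e)"
proof -
  define \<sigma> where "\<sigma> e = root 3 (det2 (u1 e) (v1 e) (u2 e) (v2 e))" for e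
  define H where "H e = det2 (u1 e) (v1 e) (u3 e) (v3 e)" for e
  define E where "E e = det2 (u2 e) (v2 e) (u3 e) (v3 e)" for e
  define dD where "dD = det2 p1 q1 (u2 e) (v2 e) + det2 (u1 e) (v1 e) p2 q2"
  define dH where "dH = det2 p1 q1 (u3 e) (v3 e) + det2 (u1 e) (v1 e) p3 q3"
  define dE where "dE = det2 p2 q2 (u3 e) (v3 e) + det2 (u2 e) (v2 e) p3 q3"
  have \<sigma>: "\<sigma> e > 0" using assms(7) by (simp add: \<sigma>_def)
  then have nz: "\<sigma> e ^ 4 \<noteq> 0" "9 * \<sigma> e ^ 7 \<noteq> 0" by auto
  have d\<sigma>: "(\<sigma> has_real_derivative dD / (3 * \<sigma> e ^ 2)) (at e)"
    using DERIV_root3[OF DERIV_det2[OF assms(1-4)]] assms(7)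
    by (simp add: \<sigma>_def[abs_def] dD_def)
  have dH: "(H has_real_derivative dH) (at e)" and dE: "(E has_real_derivative dE) (at e)"
    unfolding H_def[abs_def] E_def[abs_def] dH_def dE_def by (intro DERIV_det2 assms)+
  have "((\<lambda>e. E e / \<sigma> e ^ 4 - H e ^ 2 / (9 * \<sigma> e ^ 7)) has_real_derivative
      dE / \<sigma> e ^ 4 - 4 * E e * dD / (3 * \<sigma> e ^ 7) - 2 * H e * dH / (9 * \<sigma> e ^ 7)
      + 7 * H e ^ 2 * dD / (27 * \<sigma> e ^ 10)) (at e)"
    apply (rule derivative_eq_intros d\<sigma> dH dE nz refl)+
    using \<sigma> by (simp_all add: divide_simps) (simp add: algebra_simps eval_nat_numeral)
  then show ?thesis
    by (simp add: ea_lagrangian_def ea_lagrangian_deriv_def \<sigma>_def H_def E_def dD_def dH_def dE_def)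
qed

lemma continuous_on_ea_lagrangian:
  assumes "continuous_on S u1" "continuous_on S v1" "continuous_on S u2" "continuous_on S v2"
    "continuous_on S u3" "continuous_on S v3"
    and "\<And>z. z \<in> S \<Longrightarrow> det2 (u1 z) (v1 z) (u2 z) (v2 z) > 0"
  shows "continuous_on S (\<lambda>z. ea_lagrangian (u1 z) (v1 z) (u2 z) (v2 z) (u3 z) (v3 z))"
  unfolding ea_lagrangian_def
  by (intro continuous_intros assms) (use assms(7) in force)+

lemma continuous_on_ea_lagrangian_deriv:
  assumes "continuous_on S u1" "continuous_on S v1" "continuous_on S u2" "continuous_on S v2"
    "continuous_on S u3" "continuous_on S v3" "continuous_on S p1" "continuous_on S q1"
    "continuous_on S p2" "continuous_on S q2" "continuous_on S p3" "continuous_on S q3"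
    and "\<And>z. z \<in> S \<Longrightarrow> det2 (u1 z) (v1 z) (u2 z) (v2 z) > 0"
  shows "continuous_on S (\<lambda>z. ea_lagrangian_deriv (u1 z) (v1 z) (u2 z) (v2 z) (u3 z) (v3 z)
    (p1 z) (q1 z) (p2 z) (q2 z) (p3 z) (q3 z))"
  unfolding ea_lagrangian_deriv_def
  by (intro continuous_intros assms) (use assms(13) in force)+

text \<open>As \<open>I\<close> is open it extends beyond both ends of \<open>{a..b}\<close>, and
  the limits from outside are zero. This supplies the boundary conditions for a variation that is
  known to be fixed only outside the closed interval.\<close>

lemma continuous_on_zero_at_endpoints:
  fixes g :: "real \<Rightarrow> real"
  assumes g: "continuous_on I g" and "open I" "a \<le> b" "{a..b} \<subseteq> I"
    and zero: "\<And>t. t \<in> I - {a..b} \<Longrightarrow> g t = 0"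
  shows "g a = 0" "g b = 0"
proof -
  have lim: "(g \<longlongrightarrow> g c) (at c within T)" if "c \<in> {a..b}" for c T
  proof -
    have "isCont g c"
      using that assms(1,2,4) by (auto simp: continuous_on_eq_continuous_at)
    then show ?thesis
      unfolding isCont_def by (rule tendsto_within_subset) simp
  qed
  have "\<forall>\<^sub>F t in at_left a. g t = 0"
    unfolding eventually_at_topological using assms by (intro exI[of _ I]) auto
  from tendsto_unique[OF trivial_limit_at_left_real lim tendsto_eventually[OF this]] \<open>a \<le> b\<close>
  show "g a = 0" by simp
  have "\<forall>\<^sub>F t in at_right b. g t = 0"
    unfolding eventually_at_topological using assms by (intro exI[of _ I]) auto
  from tendsto_unique[OF trivial_limit_at_right_real lim tendsto_eventually[OF this]] \<open>a \<le> b\<close>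
  show "g b = 0" by simp
qed

text \<open>Derivatives in \<open>t\<close> are local, so agreement with a curve on an open set
  passes to all of them. It is applied to the base curve and to the complement of the
  support.\<close>

lemma pdiff_replicate_False:
  assumes "open S" "\<And>t. t \<in> S \<Longrightarrow> F e t = f t"
  shows "t \<in> S \<Longrightarrow> pdiff (replicate k False) F e t = (deriv ^^ k) f t"
proof (induction k arbitrary: t)
  case (Suc k)
  have "\<forall>\<^sub>F s in nhds t. pdiff (replicate k False) F e s = (deriv ^^ k) f s"
    using eventually_nhds_in_open[OF \<open>open S\<close> Suc.prems] by eventually_elim (rule Suc.IH)
  then show ?case by (simp add: deriv_cong_ev)
qed (use assms in auto)

subsection \<open>The first variation\<close>

text \<open>Facts on one coordinate of a variation: \<open>G k\<close> is its \<open>k\<close>-th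
  derivative in \<open>t\<close>, and \<open>P k\<close> the \<open>e\<close>-derivative of
  \<open>G k\<close>. Interchanging derivatives shows that the functions \<open>P k 0\<close> are
  the successive derivatives of the variation field \<open>P 0 0\<close>.\<close>

lemma variation_jets:
  fixes J I :: "real set"
  assumes F: "smooth2_on (J \<times> I) F" and "open J" "open I" "0 \<in> J"
    and base: "\<forall>t\<in>I. F 0 t = f t"
    and supp: "\<forall>e\<in>J. \<forall>t\<in>I - {a..b}. F e t = f t"
    and G_def: "\<And>k. G k = pdiff (replicate k False) F"
    and P_def: "\<And>k. P k = pdiff (True # replicate k False) F"
  shows "G 0 = F" "P 0 = pdiff [True] F"
    "\<And>k e t. e \<in> J \<Longrightarrow> t \<in> I \<Longrightarrow> (G k e has_real_derivative G (Suc k) e t) (at t)"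
    "\<And>k e t. e \<in> J \<Longrightarrow> t \<in> I \<Longrightarrow> ((\<lambda>e. G k e t) has_real_derivative P k e t) (at e)"
    "\<And>k t. t \<in> I \<Longrightarrow> (P k 0 has_real_derivative P (Suc k) 0 t) (at t)"
    "\<And>k. continuous_on (J \<times> I) (\<lambda>z. G k (fst z) (snd z))"
    "\<And>k. continuous_on (J \<times> I) (\<lambda>z. P k (fst z) (snd z))"
    "\<And>k t. t \<in> I \<Longrightarrow> G k 0 t = (deriv ^^ k) f t"
    "\<And>k e t. e \<in> J \<Longrightarrow> t \<in> I - {a..b} \<Longrightarrow> G k e t = (deriv ^^ k) f t"
    "\<And>k t. t \<in> I - {a..b} \<Longrightarrow> P k 0 t = 0"
proof -
  show "G 0 = F" "P 0 = pdiff [True] F"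
    by (simp_all add: G_def P_def)
  show G_fst: "((\<lambda>e. G k e t) has_real_derivative P k e t) (at e)" if "e \<in> J" "t \<in> I" for k e t
    unfolding G_def P_def by (rule smooth2_on_DERIV_fst[OF F]) (use that in auto)
  show "(G k e has_real_derivative G (Suc k) e t) (at t)" if "e \<in> J" "t \<in> I" for k e t
    using smooth2_on_DERIV_snd[OF F] that by (simp add: G_def del: pdiff.simps)
  show "(P k 0 has_real_derivative P (Suc k) 0 t) (at t)" if "t \<in> I" for k t
  proof -
    \<comment> \<open>Taking \<open>G k\<close> as the function reduces the claim to a single
      interchange of derivatives.\<close>
    have "pdiff [True] (G k) = P k" "pdiff [True, False] (G k) = P (Suc k)"
      unfolding G_def P_def by (simp_all flip: pdiff_append del: pdiff.simps)
    with smooth2_on_mixed_DERIV[OF smooth2_on_pdiff[OF F] \<open>open J\<close> \<open>open I\<close> \<open>0 \<in> J\<close> that, of "replicate k False"]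
    show ?thesis by (simp add: G_def[symmetric] del: pdiff.simps)
  qed
  show "continuous_on (J \<times> I) (\<lambda>z. G k (fst z) (snd z))"
    "continuous_on (J \<times> I) (\<lambda>z. P k (fst z) (snd z))" for k
    unfolding G_def P_def by (rule smooth2_on_continuous_on[OF F])+
  show "G k 0 t = (deriv ^^ k) f t" if "t \<in> I" for k t
    unfolding G_def using pdiff_replicate_False[of I F 0 f] base that \<open>open I\<close> by blast
  have "open (I - {a..b})"
    using \<open>open I\<close> by (intro open_Diff) auto
  then show G_supp: "G k e t = (deriv ^^ k) f t" if "e \<in> J" "t \<in> I - {a..b}" for k e t
    unfolding G_def using pdiff_replicate_False[of "I - {a..b}" F e f] supp that by blast
  show "P k 0 t = 0" if t: "t \<in> I - {a..b}" for k t
  proof -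
    \<comment> \<open>Off the support \<open>G k e t\<close> does not depend on
      \<open>e\<close>.\<close>
    have "((\<lambda>e. G k e t) has_real_derivative 0) (at 0)"
      by (rule has_field_derivative_transform_within_open[OF DERIV_const \<open>open J\<close> \<open>0 \<in> J\<close>])
        (rule G_supp[symmetric, OF _ t])
    from DERIV_unique[OF G_fst this] \<open>0 \<in> J\<close> t show ?thesis by auto
  qed
qed

text \<open>With \<open>\<xi>\<close> the variation field, \<open>T = \<gamma>'\<close> and \<open>N = \<gamma>''\<close>, the boundary term of the
  integrations by parts is \<open>|N,\<xi>''| + 2/3 \<kappa>|T,\<xi>'| + 2/3 |\<kappa> N - \<kappa>' T, \<xi>|\<close>.\<close>

lemma total_ea_curvature_first_variation:
  fixes x y \<kappa> \<kappa>1 \<kappa>2 :: "real \<Rightarrow> real"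
  assumes "open I"
    and arc: "\<And>t. t \<in> I \<Longrightarrow> det2 (deriv x t) (deriv y t) ((deriv ^^ 2) x t) ((deriv ^^ 2) y t) = 1"
    and curv: "\<And>t. t \<in> I \<Longrightarrow> (deriv ^^ 3) x t = - \<kappa> t * deriv x t"
      "\<And>t. t \<in> I \<Longrightarrow> (deriv ^^ 3) y t = - \<kappa> t * deriv y t"
    and \<kappa>: "\<And>t. t \<in> I \<Longrightarrow> (\<kappa> has_real_derivative \<kappa>1 t) (at t)"
      "\<And>t. t \<in> I \<Longrightarrow> (\<kappa>1 has_real_derivative \<kappa>2 t) (at t)"
    and "0 < \<delta>" "a \<le> b" "{a..b} \<subseteq> I"
    and X: "smooth2_on ({-\<delta><..<\<delta>} \<times> I) X" and Y: "smooth2_on ({-\<delta><..<\<delta>} \<times> I) Y"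
    and base: "\<forall>t\<in>I. X 0 t = x t" "\<forall>t\<in>I. Y 0 t = y t"
    and supp: "\<forall>e\<in>{-\<delta><..<\<delta>}. \<forall>t\<in>I - {a..b}. X e t = x t"
      "\<forall>e\<in>{-\<delta><..<\<delta>}. \<forall>t\<in>I - {a..b}. Y e t = y t"
  shows "\<exists>V. ((\<lambda>t. 2 / 3 * (\<kappa>2 t + \<kappa> t ^ 2) *
      det2 (deriv x t) (deriv y t) (pdiff [True] X 0 t) (pdiff [True] Y 0 t)) has_integral V) {a..b} \<and>
    ((\<lambda>e. total_ea_curvature a b (X e) (Y e)) has_real_derivative V) (at 0)"
proof -
  define J where "J = {-\<delta><..<\<delta>}"
  have J: "open J" "0 \<in> J" using \<open>0 < \<delta>\<close> by (auto simp: J_def)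
  define U where "U k = pdiff (replicate k False) X" for k
  define P where "P k = pdiff (True # replicate k False) X" for k
  note U = variation_jets[OF X[folded J_def] J(1) \<open>open I\<close> J(2) base(1) supp(1)[folded J_def] U_def P_def]
  define V where "V k = pdiff (replicate k False) Y" for k
  define Q where "Q k = pdiff (True # replicate k False) Y" for k
  note V = variation_jets[OF Y[folded J_def] J(1) \<open>open I\<close> J(2) base(2) supp(2)[folded J_def] V_def Q_def]
  define D where "D e t = det2 (U 1 e t) (V 1 e t) (U 2 e t) (V 2 e t)" for e t
  define L where "L e t = ea_lagrangian (U 1 e t) (V 1 e t) (U 2 e t) (V 2 e t) (U 3 e t) (V 3 e t)" for e t
  define B where "B e t = ea_boundary (U 1 e t) (V 1 e t) (U 2 e t) (V 2 e t) (U 3 e t) (V 3 e t)" for e t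
  define L' where "L' e t = ea_lagrangian_deriv (U 1 e t) (V 1 e t) (U 2 e t) (V 2 e t) (U 3 e t) (V 3 e t)
    (P 1 e t) (Q 1 e t) (P 2 e t) (Q 2 e t) (P 3 e t) (Q 3 e t)" for e t
  have cont1: "continuous_on I (U k e)" "continuous_on I (V k e)" if "e \<in> J" for k e
    by (rule DERIV_continuous_on, rule has_field_derivative_at_within,
        rule U(3)[OF that] V(3)[OF that], assumption)+
  have cont1': "continuous_on I (P k 0)" "continuous_on I (Q k 0)" for k
    by (rule DERIV_continuous_on, rule has_field_derivative_at_within,
        rule U(5) V(5), assumption)+
  have d1: "(deriv ^^ 1) f = deriv f" for f :: "real \<Rightarrow> real"
    by simp
  have D0: "D 0 t = 1" if "t \<in> I" for t
    using arc[OF that] that by (simp add: D_def U(8) V(8) d1 del: One_nat_def)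
  \<comment> \<open>Nondegeneracy is an open condition on \<open>(e, t)\<close> and holds along
    \<open>e = 0\<close>, where \<open>D\<close> is \<open>1\<close>. Compactness of
    \<open>{a..b}\<close> turns this, by the tube lemma, into a range of \<open>e\<close> valid for
    all \<open>t\<close> at once.\<close>
  have Wo: "open ((J \<times> I) \<inter> (\<lambda>z. D (fst z) (snd z)) -` {0<..})"
    unfolding D_def using J \<open>open I\<close>
    by (intro continuous_open_preimage continuous_intros U V open_Times) auto
  have Ws: "{0} \<times> {a..b} \<subseteq> (J \<times> I) \<inter> (\<lambda>z. D (fst z) (snd z)) -` {0<..}"
    using J \<open>{a..b} \<subseteq> I\<close> by (auto simp: D0)
  from Elementary_Topology.tube_lemma[OF compact_Icc Wo Ws] obtain W where W: "0 \<in> W" "open W"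
    "W \<times> {a..b} \<subseteq> (J \<times> I) \<inter> (\<lambda>z. D (fst z) (snd z)) -` {0<..}"
    by (elim exE conjE) (rule that)
  obtain r where r: "r > 0" "ball 0 r \<subseteq> W" using W openE by blast
  have inJ: "e \<in> J" and Dpos: "D e t > 0" if "e \<in> ball 0 r" "t \<in> {a..b}" for e t
  proof -
    have "(e, t) \<in> W \<times> {a..b}" using that subsetD[OF r(2)] by blast
    from subsetD[OF W(3) this] show "e \<in> J" "D e t > 0" by auto
  qed
  have inJ: "e \<in> J" if "e \<in> ball 0 r" for e
    using inJ[OF that, of a] \<open>a \<le> b\<close> by simp
  have inI: "t \<in> I" if "t \<in> {a..b}" for t using that \<open>{a..b} \<subseteq> I\<close> by auto
  have sub: "ball 0 r \<times> {a..b} \<subseteq> J \<times> I" using inJ inI by auto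
  have cont: "continuous_on (ball 0 r \<times> {a..b}) (\<lambda>z. U k (fst z) (snd z))"
    "continuous_on (ball 0 r \<times> {a..b}) (\<lambda>z. V k (fst z) (snd z))"
    "continuous_on (ball 0 r \<times> {a..b}) (\<lambda>z. P k (fst z) (snd z))"
    "continuous_on (ball 0 r \<times> {a..b}) (\<lambda>z. Q k (fst z) (snd z))" for k
    by (rule continuous_on_subset[OF _ sub], rule U V)+
  have intL: "L e integrable_on {a..b}" if "e \<in> ball 0 r" for e
    unfolding L_def
    by (intro integrable_continuous_interval continuous_on_ea_lagrangian
        continuous_on_subset[OF cont1(1)] continuous_on_subset[OF cont1(2)])
      (use Dpos that inJ inI in \<open>auto simp: D_def\<close>)
  \<comment> \<open>The two integrals differ by \<open>B e b - B e a\<close>, so the claim comes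
    down to the vanishing of \<open>B\<close> at both ends.\<close>
  have total: "integral {a..b} (L e) = total_ea_curvature a b (X e) (Y e)" if e: "e \<in> ball 0 r" for e
  proof -
    have "e \<in> J" using inJ e by blast
    \<comment> \<open>Outside \<open>{a..b}\<close> the varied curve is the original one, whose
      third derivative is parallel to its tangent; continuity carries this to the ends.\<close>
    have zero: "det2 (U 1 e c) (V 1 e c) (U 3 e c) (V 3 e c) = 0" if "c = a \<or> c = b" for c
    proof -
      let ?g = "\<lambda>t. det2 (U 1 e t) (V 1 e t) (U 3 e t) (V 3 e t)"
      have "continuous_on I ?g" by (intro continuous_intros cont1 \<open>e \<in> J\<close>)
      moreover have "?g t = 0" if "t \<in> I - {a..b}" for t
        using that \<open>e \<in> J\<close> by (simp add: U(9) V(9) d1 curv det2_def del: One_nat_def)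
      ultimately show ?thesis
        using continuous_on_zero_at_endpoints[of I ?g a b] that \<open>open I\<close> \<open>a \<le> b\<close> \<open>{a..b} \<subseteq> I\<close> by blast
    qed
    let ?f = "\<lambda>t. ea_curvature (X e) (Y e) t * ea_speed (X e) (Y e) t"
    \<comment> \<open>The density formula is applied on an open set of nondegenerate parameters;
      this one contains \<open>{a..b}\<close>.\<close>
    have S: "open (I \<inter> D e -` {0<..})"
      unfolding D_def using \<open>e \<in> J\<close> \<open>open I\<close>
      by (intro continuous_open_preimage continuous_intros cont1) auto
    have "(B e has_real_derivative ?f t - L e t) (at t)" if "t \<in> {a..b}" for t
      unfolding B_def L_def
    proof (rule ea_curvature_density[OF S])
      fix s assume "s \<in> I \<inter> D e -` {0<..}"
      then have s: "s \<in> I" "D e s > 0" by auto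
      show "(X e has_real_derivative U 1 e s) (at s)" "(Y e has_real_derivative V 1 e s) (at s)"
        using U(3)[OF \<open>e \<in> J\<close> s(1), of 0] V(3)[OF \<open>e \<in> J\<close> s(1), of 0] by (simp_all add: U(1) V(1))
      show "(U 1 e has_real_derivative U 2 e s) (at s)" "(V 1 e has_real_derivative V 2 e s) (at s)"
        "(U 2 e has_real_derivative U 3 e s) (at s)" "(V 2 e has_real_derivative V 3 e s) (at s)"
        "(U 3 e has_real_derivative U 4 e s) (at s)" "(V 3 e has_real_derivative V 4 e s) (at s)"
        using U(3)[OF \<open>e \<in> J\<close> s(1), of 1] V(3)[OF \<open>e \<in> J\<close> s(1), of 1]
          U(3)[OF \<open>e \<in> J\<close> s(1), of 2] V(3)[OF \<open>e \<in> J\<close> s(1), of 2]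
          U(3)[OF \<open>e \<in> J\<close> s(1), of 3] V(3)[OF \<open>e \<in> J\<close> s(1), of 3]
        by (simp_all add: eval_nat_numeral)
      show "det2 (U 1 e s) (V 1 e s) (U 2 e s) (V 2 e s) > 0"
        using s by (simp add: D_def)
    qed (use that inI Dpos e in auto)
    then have "((\<lambda>t. ?f t - L e t) has_integral (B e b - B e a)) {a..b}"
      using \<open>a \<le> b\<close> by (intro fundamental_theorem_of_calculus)
        (auto simp: has_real_derivative_iff_has_vector_derivative intro: has_vector_derivative_at_within)
    then have "((\<lambda>t. ?f t - L e t) has_integral 0) {a..b}"
      by (simp add: B_def ea_boundary_def zero del: One_nat_def)
    from has_integral_add[OF this integrable_integral[OF intL[OF e]]]
    show ?thesis
      by (simp add: total_ea_curvature_def integral_unique)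
  qed
  \<comment> \<open>Differentiation under the integral sign, justified by joint continuity of
    \<open>L'\<close>.\<close>
  have "((\<lambda>e. integral (cbox a b) (L e)) has_real_derivative integral (cbox a b) (L' 0)) (at 0 within ball 0 r)"
  proof (rule leibniz_rule_field_derivative)
    show "((\<lambda>e. L e t) has_real_derivative L' e t) (at e within ball 0 r)"
      if "e \<in> ball 0 r" "t \<in> cbox a b" for e t
    proof -
      have "e \<in> J" "t \<in> I" "D e t > 0" using that inJ inI Dpos by auto
      then have "((\<lambda>e. L e t) has_real_derivative L' e t) (at e)"
        unfolding L_def L'_def D_def by (intro DERIV_ea_lagrangian U(4) V(4))
      then show ?thesis by (rule has_field_derivative_at_within)
    qed
    show "continuous_on (ball 0 r \<times> cbox a b) (\<lambda>(e, t). L' e t)"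
      unfolding L'_def case_prod_beta cbox_interval
      by (intro continuous_on_ea_lagrangian_deriv cont) (use Dpos in \<open>auto simp: D_def\<close>)
  qed (use intL r in auto)
  then have "((\<lambda>e. integral {a..b} (L e)) has_real_derivative integral {a..b} (L' 0)) (at 0)"
    using r by (simp add: at_within_open[of 0 "ball 0 r"])
  then have deriv: "((\<lambda>e. total_ea_curvature a b (X e) (Y e)) has_real_derivative integral {a..b} (L' 0)) (at 0)"
    by (rule has_field_derivative_transform_within_open[where S = "ball 0 r"]) (use r total in auto)
  define M where "M t = det2 (U 2 0 t) (V 2 0 t) (P 2 0 t) (Q 2 0 t)
      + 2 / 3 * \<kappa> t * det2 (U 1 0 t) (V 1 0 t) (P 1 0 t) (Q 1 0 t)
      + 2 / 3 * (\<kappa> t * det2 (U 2 0 t) (V 2 0 t) (P 0 0 t) (Q 0 0 t)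
        - \<kappa>1 t * det2 (U 1 0 t) (V 1 0 t) (P 0 0 t) (Q 0 0 t))" for t
  let ?EL = "\<lambda>t. 2 / 3 * (\<kappa>2 t + \<kappa> t ^ 2) * det2 (U 1 0 t) (V 1 0 t) (P 0 0 t) (Q 0 0 t)"
  have dM: "(M has_real_derivative L' 0 t - ?EL t) (at t)" if t: "t \<in> {a..b}" for t
  proof -
    have tI: "t \<in> I" using inI t .
    have U3: "U 3 0 t = - \<kappa> t * U 1 0 t" "V 3 0 t = - \<kappa> t * V 1 0 t"
      using curv[OF tI] by (simp_all add: U(8) V(8) tI d1 del: One_nat_def)
    have D1: "det2 (U 1 0 t) (V 1 0 t) (U 2 0 t) (V 2 0 t) = 1"
      using arc[OF tI] by (simp add: U(8) V(8) tI d1 del: One_nat_def)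
    have H: "det2 (U 1 0 t) (V 1 0 t) (U 3 0 t) (V 3 0 t) = 0"
      by (simp add: U3 det2_def)
    have E: "det2 (U 2 0 t) (V 2 0 t) (U 3 0 t) (V 3 0 t) = \<kappa> t"
      using D1 unfolding U3 det2_def by algebra
    have d: "(U 1 0 has_real_derivative U 2 0 t) (at t)" "(V 1 0 has_real_derivative V 2 0 t) (at t)"
        "(U 2 0 has_real_derivative U 3 0 t) (at t)" "(V 2 0 has_real_derivative V 3 0 t) (at t)"
        "(P 0 0 has_real_derivative P 1 0 t) (at t)" "(Q 0 0 has_real_derivative Q 1 0 t) (at t)"
        "(P 1 0 has_real_derivative P 2 0 t) (at t)" "(Q 1 0 has_real_derivative Q 2 0 t) (at t)"
        "(P 2 0 has_real_derivative P 3 0 t) (at t)" "(Q 2 0 has_real_derivative Q 3 0 t) (at t)"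
      using U(3)[OF J(2) tI, of 1] V(3)[OF J(2) tI, of 1] U(3)[OF J(2) tI, of 2] V(3)[OF J(2) tI, of 2]
        U(5)[OF tI, of 0] V(5)[OF tI, of 0] U(5)[OF tI, of 1] V(5)[OF tI, of 1]
        U(5)[OF tI, of 2] V(5)[OF tI, of 2]
      by (simp_all add: eval_nat_numeral)
    \<comment> \<open>At \<open>e = 0\<close> the speed is \<open>1\<close> and |c',c'''| is
      \<open>0\<close>, which removes the last two terms of the differential, and |c'',c'''| is the
      curvature.\<close>
    have L'0: "L' 0 t = det2 (P 2 0 t) (Q 2 0 t) (U 3 0 t) (V 3 0 t) + det2 (U 2 0 t) (V 2 0 t) (P 3 0 t) (Q 3 0 t)
      - 4 / 3 * \<kappa> t * (det2 (P 1 0 t) (Q 1 0 t) (U 2 0 t) (V 2 0 t) + det2 (U 1 0 t) (V 1 0 t) (P 2 0 t) (Q 2 0 t))"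
      by (simp add: L'_def ea_lagrangian_deriv_def D1 H E del: One_nat_def)
    show ?thesis
      unfolding M_def[abs_def]
      apply (rule derivative_eq_intros DERIV_det2 d \<kappa> tI refl)+
      unfolding L'0 U3 det2_def
      by (simp add: field_simps power2_eq_square)
  qed
  \<comment> \<open>The variation field vanishes at both ends together with all its derivatives,
    hence so does \<open>M\<close>.\<close>
  have "P k 0 c = 0" "Q k 0 c = 0" if "c = a \<or> c = b" for k c
    using continuous_on_zero_at_endpoints[of I _ a b] cont1' U(10) V(10) that
      \<open>open I\<close> \<open>a \<le> b\<close> \<open>{a..b} \<subseteq> I\<close> by metis+
  then have "M a = 0" "M b = 0"
    by (simp_all add: M_def det2_def)
  moreover have "((\<lambda>t. L' 0 t - ?EL t) has_integral (M b - M a)) {a..b}"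
    using dM \<open>a \<le> b\<close> by (intro fundamental_theorem_of_calculus)
      (auto simp: has_real_derivative_iff_has_vector_derivative intro: has_vector_derivative_at_within)
  moreover have "L' 0 integrable_on {a..b}"
    unfolding L'_def
    by (intro integrable_continuous_interval continuous_on_ea_lagrangian_deriv
        continuous_on_subset[OF cont1(1)] continuous_on_subset[OF cont1(2)]
        continuous_on_subset[OF cont1'(1)] continuous_on_subset[OF cont1'(2)])
      (use Dpos[of 0] r J inI in \<open>auto simp: D_def\<close>)
  ultimately have "((\<lambda>t. L' 0 t - (L' 0 t - ?EL t)) has_integral (integral {a..b} (L' 0) - 0)) {a..b}"
    by (intro has_integral_diff integrable_integral) auto
  then have "(?EL has_integral integral {a..b} (L' 0)) {a..b}"
    by simp
  then have "((\<lambda>t. 2 / 3 * (\<kappa>2 t + \<kappa> t ^ 2) *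
      det2 (deriv x t) (deriv y t) (pdiff [True] X 0 t) (pdiff [True] Y 0 t))
      has_integral integral {a..b} (L' 0)) {a..b}"
    by (rule has_integral_eq[rotated]) (use inI in \<open>simp add: U(2,8) V(2,8) d1 del: pdiff.simps One_nat_def\<close>)
  with deriv show ?thesis by blast
qed

subsection \<open>The Euler--Lagrange equation\<close>

text \<open>The hypotheses determine \<open>\<kappa>\<close> only through the equation for the third
  derivative. Pairing that equation with the normal gives
  \<open>\<kappa> = |\<gamma>'',\<gamma>'''|\<close> on \<open>I\<close>, a polynomial in
  derivatives of the smooth functions \<open>x\<close> and \<open>y\<close>.\<close>

lemma arclength_curvature_DERIV:
  fixes x y \<kappa> :: "real \<Rightarrow> real"
  assumes "open I" and x: "smooth1_on I x" and y: "smooth1_on I y"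
    and arc: "\<And>t. t \<in> I \<Longrightarrow> det2 (deriv x t) (deriv y t) ((deriv ^^ 2) x t) ((deriv ^^ 2) y t) = 1"
    and curv: "\<And>t. t \<in> I \<Longrightarrow> (deriv ^^ 3) x t = - \<kappa> t * deriv x t"
      "\<And>t. t \<in> I \<Longrightarrow> (deriv ^^ 3) y t = - \<kappa> t * deriv y t"
  obtains \<kappa>1 \<kappa>2 where "\<And>t. t \<in> I \<Longrightarrow> (\<kappa> has_real_derivative \<kappa>1 t) (at t)"
    "\<And>t. t \<in> I \<Longrightarrow> (\<kappa>1 has_real_derivative \<kappa>2 t) (at t)" "continuous_on I \<kappa>2"
proof
  let ?x = "\<lambda>k. (deriv ^^ k) x" and ?y = "\<lambda>k. (deriv ^^ k) y"
  let ?d = "\<lambda>j k t. det2 (?x j t) (?y j t) (?x k t) (?y k t)"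
  have d: "(?d j k has_real_derivative ?d (Suc j) k t + ?d j (Suc k) t) (at t)" if "t \<in> I" for j k t
    by (intro DERIV_det2 smooth1_on_DERIV[OF x that] smooth1_on_DERIV[OF y that])
  have \<kappa>: "?d 2 3 t = \<kappa> t" if "t \<in> I" for t
  proof -
    have "?d 2 3 t = \<kappa> t * det2 (deriv x t) (deriv y t) (?x 2 t) (?y 2 t)"
      by (simp only: curv[OF that] det2_def) (simp add: algebra_simps)
    with arc[OF that] show ?thesis by simp
  qed
  have c: "continuous_on I (?d j k)" for j k
    by (rule DERIV_continuous_on, rule has_field_derivative_at_within, rule d)
  let ?\<kappa>1 = "\<lambda>t. ?d 3 3 t + ?d 2 4 t"
  let ?\<kappa>2 = "\<lambda>t. (?d 4 3 t + ?d 3 4 t) + (?d 3 4 t + ?d 2 5 t)"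
  show "(\<kappa> has_real_derivative ?\<kappa>1 t) (at t)" if "t \<in> I" for t
    using has_field_derivative_transform_within_open[OF d[OF that, of 2 3] \<open>open I\<close> that \<kappa>]
    by simp
  show "(?\<kappa>1 has_real_derivative ?\<kappa>2 t) (at t)" if "t \<in> I" for t
    using DERIV_add[OF d[OF that, of 3 3] d[OF that, of 2 4]]
    by simp
  show "continuous_on I ?\<kappa>2"
    by (intro continuous_on_add c)
qed

text \<open>The coefficients \<open>A\<close>, \<open>B\<close> are the Wronskians of \<open>\<kappa>\<close> with \<open>y'\<close> and of \<open>x'\<close> with \<open>\<kappa>\<close>.\<close>

lemma euler_lagrange_iff_linear:
  fixes x1 y1 x2 y2 \<kappa> \<kappa>1 \<kappa>2 :: "real \<Rightarrow> real"
  assumes "open I" "is_interval I"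
    and d: "\<And>t. t \<in> I \<Longrightarrow> (x1 has_real_derivative x2 t) (at t)"
      "\<And>t. t \<in> I \<Longrightarrow> (x2 has_real_derivative - \<kappa> t * x1 t) (at t)"
      "\<And>t. t \<in> I \<Longrightarrow> (y1 has_real_derivative y2 t) (at t)"
      "\<And>t. t \<in> I \<Longrightarrow> (y2 has_real_derivative - \<kappa> t * y1 t) (at t)"
      "\<And>t. t \<in> I \<Longrightarrow> (\<kappa> has_real_derivative \<kappa>1 t) (at t)"
      "\<And>t. t \<in> I \<Longrightarrow> (\<kappa>1 has_real_derivative \<kappa>2 t) (at t)"
    and arc: "\<And>t. t \<in> I \<Longrightarrow> det2 (x1 t) (y1 t) (x2 t) (y2 t) = 1"
  shows "(\<forall>t\<in>I. \<kappa>2 t + \<kappa> t ^ 2 = 0) \<longleftrightarrow> (\<exists>A B. \<forall>t\<in>I. \<kappa> t = A * x1 t + B * y1 t)"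
proof
  assume EL: "\<forall>t\<in>I. \<kappa>2 t + \<kappa> t ^ 2 = 0"
  \<comment> \<open>By the Euler-Lagrange equation \<open>\<kappa>\<close> solves the same equation
    as \<open>x1\<close> and \<open>y1\<close>, and Wronskians of solutions of
    \<open>f'' = -\<kappa> f\<close> are constant.\<close>
  have W: "((\<lambda>t. \<kappa> t * y2 t - \<kappa>1 t * y1 t) has_real_derivative 0) (at t within I)"
    "((\<lambda>t. x1 t * \<kappa>1 t - \<kappa> t * x2 t) has_real_derivative 0) (at t within I)" if t: "t \<in> I" for t
  proof -
    have \<kappa>2: "\<kappa>2 t = - (\<kappa> t * \<kappa> t)"
      using bspec[OF EL t] by (simp add: power2_eq_square)
    show "((\<lambda>t. \<kappa> t * y2 t - \<kappa>1 t * y1 t) has_real_derivative 0) (at t within I)"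
      by (rule has_field_derivative_at_within, (rule derivative_eq_intros d t refl)+)
        (simp add: \<kappa>2 algebra_simps)
    show "((\<lambda>t. x1 t * \<kappa>1 t - \<kappa> t * x2 t) has_real_derivative 0) (at t within I)"
      by (rule has_field_derivative_at_within, (rule derivative_eq_intros d t refl)+)
        (simp add: \<kappa>2 algebra_simps)
  qed
  note const = has_field_derivative_zero_constant[OF is_interval_convex[OF \<open>is_interval I\<close>]]
  obtain A where A: "\<forall>t\<in>I. \<kappa> t * y2 t - \<kappa>1 t * y1 t = A" using const[OF W(1)] by blast
  obtain B where B: "\<forall>t\<in>I. x1 t * \<kappa>1 t - \<kappa> t * x2 t = B" using const[OF W(2)] by blast
  have "\<kappa> t = A * x1 t + B * y1 t" if t: "t \<in> I" for t
  proof -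
    \<comment> \<open>Cramer's rule: after expansion the terms with \<open>\<kappa>1\<close>
      cancel.\<close>
    have "A * x1 t + B * y1 t = \<kappa> t * det2 (x1 t) (y1 t) (x2 t) (y2 t)"
      unfolding bspec[OF A t, symmetric] bspec[OF B t, symmetric] det2_def
      by (simp add: algebra_simps)
    with arc[OF t] show ?thesis by simp
  qed
  then show "\<exists>A B. \<forall>t\<in>I. \<kappa> t = A * x1 t + B * y1 t" by blast
next
  assume "\<exists>A B. \<forall>t\<in>I. \<kappa> t = A * x1 t + B * y1 t"
  then obtain A B where AB: "\<And>t. t \<in> I \<Longrightarrow> A * x1 t + B * y1 t = \<kappa> t" by metis
  \<comment> \<open>Conversely, the linear relation is differentiated twice; openness of
    \<open>I\<close> permits differentiating an identity that holds on \<open>I\<close>.\<close>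
  have \<kappa>1: "A * x2 t + B * y2 t = \<kappa>1 t" if t: "t \<in> I" for t
  proof -
    have "((\<lambda>t. A * x1 t + B * y1 t) has_real_derivative A * x2 t + B * y2 t) (at t)"
      by (intro DERIV_add DERIV_cmult d t)
    from has_field_derivative_transform_within_open[OF this \<open>open I\<close> t AB] d(5)[OF t]
    show ?thesis by (rule DERIV_unique)
  qed
  show "\<forall>t\<in>I. \<kappa>2 t + \<kappa> t ^ 2 = 0"
  proof
    fix t assume t: "t \<in> I"
    have "((\<lambda>t. A * x2 t + B * y2 t) has_real_derivative A * (- \<kappa> t * x1 t) + B * (- \<kappa> t * y1 t)) (at t)"
      by (intro DERIV_add DERIV_cmult d t)
    from has_field_derivative_transform_within_open[OF this \<open>open I\<close> t \<kappa>1] d(6)[OF t]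
    have "A * (- \<kappa> t * x1 t) + B * (- \<kappa> t * y1 t) = \<kappa>2 t" by (rule DERIV_unique)
    then have "\<kappa>2 t = - \<kappa> t * (A * x1 t + B * y1 t)" by (simp add: algebra_simps)
    with AB[OF t] show "\<kappa>2 t + \<kappa> t ^ 2 = 0" by (simp add: power2_eq_square)
  qed
qed

section \<open>The first variation tested on bump-shaped fields\<close>

theorem theorem2:
  fixes x y \<kappa> :: "real \<Rightarrow> real" and I :: "real set"
  assumes "open I" and "is_interval I" and "I \<noteq> {}"
    and "smooth1_on I x" and "smooth1_on I y"
    and "\<forall>t\<in>I. det2 (deriv x t) (deriv y t) ((deriv ^^ 2) x t) ((deriv ^^ 2) y t) = 1"
    and "\<forall>t\<in>I. (deriv ^^ 3) x t = - \<kappa> t * deriv x t \<and> (deriv ^^ 3) y t = - \<kappa> t * deriv y t"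
  shows "ea_total_curvature_critical I x y \<longleftrightarrow>
         (\<exists>A B. \<forall>t\<in>I. \<kappa> t = A * deriv x t + B * deriv y t)"
proof -
  note I = \<open>open I\<close> and x = \<open>smooth1_on I x\<close> and y = \<open>smooth1_on I y\<close>
  have arc: "\<And>t. t \<in> I \<Longrightarrow> det2 (deriv x t) (deriv y t) ((deriv ^^ 2) x t) ((deriv ^^ 2) y t) = 1"
    and curv: "\<And>t. t \<in> I \<Longrightarrow> (deriv ^^ 3) x t = - \<kappa> t * deriv x t"
      "\<And>t. t \<in> I \<Longrightarrow> (deriv ^^ 3) y t = - \<kappa> t * deriv y t"
    using assms(6,7) by auto
  obtain \<kappa>1 \<kappa>2 where \<kappa>: "\<And>t. t \<in> I \<Longrightarrow> (\<kappa> has_real_derivative \<kappa>1 t) (at t)"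
    "\<And>t. t \<in> I \<Longrightarrow> (\<kappa>1 has_real_derivative \<kappa>2 t) (at t)" and "continuous_on I \<kappa>2"
    using arclength_curvature_DERIV[OF I x y arc curv] by blast
  note variation = total_ea_curvature_first_variation[OF I arc curv \<kappa>]
  define g where "g t = \<kappa>2 t + \<kappa> t ^ 2" for t
  have d: "(deriv x has_real_derivative (deriv ^^ 2) x t) (at t)"
    "((deriv ^^ 2) x has_real_derivative - \<kappa> t * deriv x t) (at t)"
    "(deriv y has_real_derivative (deriv ^^ 2) y t) (at t)"
    "((deriv ^^ 2) y has_real_derivative - \<kappa> t * deriv y t) (at t)" if t: "t \<in> I" for t
    using smooth1_on_DERIV[OF x t, of 1] smooth1_on_DERIV[OF x t, of 2]
      smooth1_on_DERIV[OF y t, of 1] smooth1_on_DERIV[OF y t, of 2] curv[OF t]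
    by (simp_all add: eval_nat_numeral)
  have EL_iff: "(\<forall>t\<in>I. g t = 0) \<longleftrightarrow> (\<exists>A B. \<forall>t\<in>I. \<kappa> t = A * deriv x t + B * deriv y t)"
    unfolding g_def by (rule euler_lagrange_iff_linear[OF I \<open>is_interval I\<close> d \<kappa> arc])
  have "ea_total_curvature_critical I x y \<longleftrightarrow> (\<forall>t\<in>I. g t = 0)"
  proof
    assume EL: "\<forall>t\<in>I. g t = 0"
    show "ea_total_curvature_critical I x y"
      unfolding ea_total_curvature_critical_def
    proof (intro allI impI, elim conjE)
      fix X Y \<delta> a b
      assume *: "0 < \<delta>" "a \<le> b" "{a..b} \<subseteq> I"
        "smooth2_on ({-\<delta><..<\<delta>} \<times> I) X" "smooth2_on ({-\<delta><..<\<delta>} \<times> I) Y"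
        "\<forall>t\<in>I. X 0 t = x t \<and> Y 0 t = y t"
        "\<forall>e\<in>{-\<delta><..<\<delta>}. \<forall>t\<in>I - {a..b}. X e t = x t \<and> Y e t = y t"
      then obtain V where V: "((\<lambda>t. 2 / 3 * (\<kappa>2 t + \<kappa> t ^ 2) *
          det2 (deriv x t) (deriv y t) (pdiff [True] X 0 t) (pdiff [True] Y 0 t)) has_integral V) {a..b}"
        "((\<lambda>e. total_ea_curvature a b (X e) (Y e)) has_real_derivative V) (at 0)"
        using variation[of \<delta> a b X Y] by blast
      have "((\<lambda>t. 2 / 3 * (\<kappa>2 t + \<kappa> t ^ 2) *
          det2 (deriv x t) (deriv y t) (pdiff [True] X 0 t) (pdiff [True] Y 0 t)) has_integral 0) {a..b}"
      proof (rule has_integral_is_0)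
        fix t assume "t \<in> {a..b}"
        with EL *(3) have "\<kappa>2 t + \<kappa> t ^ 2 = 0" by (auto simp: g_def)
        then show "2 / 3 * (\<kappa>2 t + \<kappa> t ^ 2) *
            det2 (deriv x t) (deriv y t) (pdiff [True] X 0 t) (pdiff [True] Y 0 t) = 0"
          by (simp only: mult_zero_left mult_zero_right)
      qed
      with V show "((\<lambda>e. total_ea_curvature a b (X e) (Y e)) has_real_derivative 0) (at 0)"
        using has_integral_unique by blast
    qed
  next
    assume crit: "ea_total_curvature_critical I x y"
    show "\<forall>t\<in>I. g t = 0"
    proof (rule ccontr)
      assume "\<not> (\<forall>t\<in>I. g t = 0)"
      then obtain t0 where t0: "t0 \<in> I" "g t0 \<noteq> 0" by blast
      \<comment> \<open>The tangent at \<open>t0\<close> turned by a right angle and scaled by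
        \<open>g t0\<close>. The factor \<open>g t0\<close> makes \<open>h t0\<close> a positive
        multiple of the square of \<open>g t0\<close>, whatever the sign of
        \<open>g t0\<close>.\<close>
      define \<alpha> \<beta> where "\<alpha> = - g t0 * deriv y t0" and "\<beta> = g t0 * deriv x t0"
      define h where "h t = 2 / 3 * g t * det2 (deriv x t) (deriv y t) \<alpha> \<beta>" for t
      have "continuous_on I \<kappa>" "continuous_on I (deriv x)" "continuous_on I (deriv y)"
        using \<kappa>(1) smooth1_on_imp_continuous_on[OF smooth1_on_deriv[OF x]]
          smooth1_on_imp_continuous_on[OF smooth1_on_deriv[OF y]]
        by (auto simp: continuous_on_eq_continuous_at[OF I] intro: DERIV_isCont)
      then have cont_h: "continuous_on I h"
        unfolding h_def[abs_def] g_def det2_def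
        using \<open>continuous_on I \<kappa>2\<close> by (intro continuous_intros)
      have "deriv x t0 \<noteq> 0 \<or> deriv y t0 \<noteq> 0"
        using arc[OF t0(1)] by (auto simp: det2_def)
      then have "(deriv x t0)\<^sup>2 + (deriv y t0)\<^sup>2 > 0"
        by (simp add: sum_power2_gt_zero_iff)
      then have "0 < 2 / 3 * (g t0)\<^sup>2 * ((deriv x t0)\<^sup>2 + (deriv y t0)\<^sup>2)"
        using t0(2) by (intro mult_pos_pos) auto
      also have "2 / 3 * (g t0)\<^sup>2 * ((deriv x t0)\<^sup>2 + (deriv y t0)\<^sup>2) = h t0"
        by (simp add: h_def \<alpha>_def \<beta>_def det2_def power2_eq_square algebra_simps)
      finally have h0: "h t0 > 0" .
      have "open (I \<inter> h -` {0<..})"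
        by (intro continuous_open_preimage cont_h I) auto
      then obtain r where r: "r > 0" "cball t0 r \<subseteq> I \<inter> h -` {0<..}"
        using t0(1) h0 open_contains_cball by (metis IntI greaterThan_iff vimageI)
      define a b where "a = t0 - r" and "b = t0 + r"
      have ab: "a < t0" "t0 < b" using r(1) by (auto simp: a_def b_def)
      have abI: "t \<in> I \<and> h t > 0" if "t \<in> {a..b}" for t
        using that subsetD[OF r(2), of t] by (simp add: a_def b_def dist_real_def) linarith
      obtain \<phi> where \<phi>: "\<And>n S. n_diff_on n S \<phi>" "\<And>t. a < t \<Longrightarrow> t < b \<Longrightarrow> \<phi> t > 0"
        "\<And>t. t \<le> a \<or> b \<le> t \<Longrightarrow> \<phi> t = 0"
        using smooth_bump_exists[of a b] by blast
      \<comment> \<open>The curve is moved along straight lines in the constant direction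
        \<open>(\<alpha>, \<beta>)\<close>, weighted by the bump, so it stays fixed outside
        \<open>{a..b}\<close> and its first variation is the integral of
        \<open>\<phi> t * h t\<close>.\<close>
      define X where "X e t = x t + e * (\<alpha> * \<phi> t)" for e t
      define Y where "Y e t = y t + e * (\<beta> * \<phi> t)" for e t
      have smooth: "smooth1_on I (\<lambda>t. c * \<phi> t)" for c
        by (simp add: smooth1_on_iff_n_diff_on[OF I] n_diff_on_mult n_diff_on_const \<phi>(1))
      have sX: "smooth2_on ({-1<..<1} \<times> I) X" and sY: "smooth2_on ({-1<..<1} \<times> I) Y"
        unfolding X_def[abs_def] Y_def[abs_def]
        by (intro smooth2_on_linear I x y smooth open_greaterThanLessThan)+
      have dX: "pdiff [True] X 0 t = \<alpha> * \<phi> t" and dY: "pdiff [True] Y 0 t = \<beta> * \<phi> t" for t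
        by (auto simp: X_def Y_def intro!: DERIV_imp_deriv derivative_eq_intros)
      have base: "\<forall>t\<in>I. X 0 t = x t" "\<forall>t\<in>I. Y 0 t = y t"
        by (simp_all add: X_def Y_def)
      have supp: "\<forall>e\<in>{-1<..<1}. \<forall>t\<in>I - {a..b}. X e t = x t"
        "\<forall>e\<in>{-1<..<1}. \<forall>t\<in>I - {a..b}. Y e t = y t"
        using \<phi>(3) by (auto simp: X_def Y_def)
      have abI': "{a..b} \<subseteq> I" using abI by auto
      have "((\<lambda>e. total_ea_curvature a b (X e) (Y e)) has_real_derivative 0) (at 0)"
        using crit[unfolded ea_total_curvature_critical_def, rule_format, of 1 a b X Y]
          sX sY base supp ab abI' by simp
      moreover obtain V where V: "((\<lambda>t. 2 / 3 * (\<kappa>2 t + \<kappa> t ^ 2) *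
          det2 (deriv x t) (deriv y t) (pdiff [True] X 0 t) (pdiff [True] Y 0 t)) has_integral V) {a..b}"
        "((\<lambda>e. total_ea_curvature a b (X e) (Y e)) has_real_derivative V) (at 0)"
        using variation[of 1 a b X Y] ab sX sY base supp abI' by auto
      ultimately have "V = 0" using DERIV_unique by blast
      moreover have "2 / 3 * (\<kappa>2 t + \<kappa> t ^ 2) *
          det2 (deriv x t) (deriv y t) (pdiff [True] X 0 t) (pdiff [True] Y 0 t) = \<phi> t * h t" for t
      proof -
        have "det2 (deriv x t) (deriv y t) (\<alpha> * \<phi> t) (\<beta> * \<phi> t)
            = \<phi> t * det2 (deriv x t) (deriv y t) \<alpha> \<beta>"
          by (simp add: det2_def algebra_simps)
        then show ?thesis
          unfolding dX dY h_def g_def by (simp only: mult_ac)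
      qed
      ultimately have int: "((\<lambda>t. \<phi> t * h t) has_integral 0) (cbox a b)"
        using V(1) by simp
      have cont_\<phi>: "continuous_on I \<phi>"
        using smooth1_on_imp_continuous_on[OF smooth[of 1]] by simp
      have nonneg: "\<phi> t * h t \<ge> 0" if "t \<in> cbox a b" for t
        using abI[of t] \<phi>(2)[of t] \<phi>(3)[of t] that
        by (cases "a < t \<and> t < b") (auto intro: mult_nonneg_nonneg)
      \<comment> \<open>A continuous nonnegative function with integral zero vanishes, but at
        \<open>t0\<close> both factors are positive.\<close>
      have "continuous_on (cbox a b) (\<lambda>t. \<phi> t * h t)"
        by (rule continuous_on_subset[OF continuous_on_mult[OF cont_\<phi> cont_h]]) (use abI' in simp)
      from has_integral_0_cbox_imp_0[OF this nonneg int] have "\<phi> t0 * h t0 = 0"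
        using ab by simp
      with h0 \<phi>(2)[OF ab] show False by simp
    qed
  qed
  with EL_iff show ?thesis by simp
qed

end
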